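(* Let $\xi\in[0,1)$, $\alpha_0=-2\log(1-\xi)$ and $\beta_0=\xi/(1-\xi)^2$. The $q$-Bessel kernel is asymptotic to the Airy kernel in the following limit (the edge scaling limit): $$\lim_{q\to1}\Big(-\frac{\beta_0}{\log q}\Big)^{\frac13}K_{q\mathrm{B}}\Big(-\frac{\alpha_0}{\log q}+\Big(-\frac{\beta_0}{\log q}\Big)^{\frac13}x,\,-\frac{\alpha_0}{\log q}+\Big(-\frac{\beta_0}{\log q}\Big)^{\frac13}y\Big)=K_{\mathrm{Ai}}(x,y).$$
   Context: For $q,\xi\in[0,1)$ the $q$-Bessel kernel is $$K_{q\mathrm{B}}(r,s)=\xi\,\frac{J_{r+\frac12}J_{s-\frac12}-J_{r-\frac12}J_{s+\frac12}}{q^{\frac12(r-s)}-q^{-\frac12(r-s)}},\qquad r,s\in\mathbb{Z}+\tfrac12,$$ with $J_n=J^{(3)}_n(2\xi;q)$; this quotient is the closed form of the series $q^{\frac12(r+s)}\sum_{k\in\{\frac12,\frac32,\dots\}}q^kJ_{r+k}J_{s+k}$. Here, with $(a;q)_n=\prod_{k=0}^{n-1}(1-aq^k)$ and $(a;q)_\infty=\prod_{k\ge0}(1-aq^k)$, the Hahn--Exton $q$-Bessel function is $$J^{(3)}_\nu(x;q)=\frac{(q^{\nu+1};q)_\infty}{(q;q)_\infty}\Big(\frac x2\Big)^\nu\sum_{k\ge0}\frac{(-1)^kq^{k(k-1)/2}}{(q;q)_k\,(q^{\nu+1};q)_k}\Big(\frac{qx^2}4\Big)^k,$$ and for integer orders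 (including negative ones) it is given by the generating function $\dfrac{(qx/2z;q)_\infty}{(xz/2;q)_\infty}=\sum_{n\in\mathbb{Z}}z^nJ^{(3)}_n(x;q)$. In the limit, $\xi$, $x$, $y$ are fixed. The Airy kernel is $$K_{\mathrm{Ai}}(x,y)=\int_0^\infty\mathrm{Ai}(x+z)\mathrm{Ai}(y+z)\,dz=\frac{\mathrm{Ai}(x)\mathrm{Ai}'(y)-\mathrm{Ai}'(x)\mathrm{Ai}(y)}{x-y},$$ where $\mathrm{Ai}(x)=\frac1{2\pi i}\int_{i\mathbb{R}}e^{z^3/3-xz}\,dz$ is the Airy function.
   Formalization: The case ξ=0 is excluded (0<ξ<1), since there β₀=0 makes the left side 0 while K_Ai(x,x)>0; the real arguments of the kernel are read as any half-integers at distance less than 1 from them. *)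

theory Defs
  imports "HOL-Complex_Analysis.Complex_Analysis"
begin

definition qpoch :: "'a::real_normed_field \<Rightarrow> 'a \<Rightarrow> nat \<Rightarrow> 'a" where
  "qpoch a q n = (\<Prod>k<n. 1 - a * q ^ k)"

definition qpoch_inf :: "'a::real_normed_field \<Rightarrow> 'a \<Rightarrow> 'a" where
  "qpoch_inf a q = (\<Prod>k. 1 - a * q ^ k)"

text \<open>
  Integer orders: the coefficients of the Laurent expansion of the generating function
  in its annulus of convergence \<open>0 < \<bar>z\<bar> < 2 / \<bar>x\<bar>\<close>.
\<close>
definition hahn_exton_int :: "int \<Rightarrow> real \<Rightarrow> real \<Rightarrow> real" where
  "hahn_exton_int n x q =
     (THE c :: int \<Rightarrow> real.
        \<forall>z::complex. z \<noteq> 0 \<and> norm (of_real x * z / 2) < 1 \<longrightarrow>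
          ((\<lambda>m. of_real (c m) * z powi m) has_sum
             (qpoch_inf (of_real (q * x) / (2 * z)) (of_real q) /
              qpoch_inf (of_real x * z / 2) (of_real q))) UNIV) n"

text \<open>
  The Hahn--Exton \<open>q\<close>-Bessel function \<open>J\<^sup>(\<^sup>3\<^sup>)\<^sub>\<nu>(x; q)\<close>. The series below has vanishing
  denominators when \<open>\<nu>\<close> is a negative integer, which is why integer orders are read off
  from the generating function; the two agree for \<open>\<nu> = 0, 1, 2, \<dots>\<close>.
\<close>
definition hahn_exton :: "real \<Rightarrow> real \<Rightarrow> real \<Rightarrow> real" where
  "hahn_exton \<nu> x q =
     (if \<nu> \<in> \<int> then hahn_exton_int \<lfloor>\<nu>\<rfloor> x q
      else qpoch_inf (q powr (\<nu> + 1)) q / qpoch_inf q q * (x / 2) powr \<nu> *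
        (\<Sum>k. (-1) ^ k * q ^ (k * (k - 1) div 2) / (qpoch q q k * qpoch (q powr (\<nu> + 1)) q k)
               * (q * x\<^sup>2 / 4) ^ k))"

definition half_integers :: "real set" where
  "half_integers = {r. r - 1/2 \<in> \<int>}"

text \<open>
  On the diagonal the quotient is \<open>0/0\<close>; there the kernel is given by the series
  \<open>q\<^bsup>(r+s)/2\<^esup> \<Sum>\<^sub>k q\<^sup>k J\<^bsub>r+k\<^esub> J\<^bsub>s+k\<^esub>\<close> over \<open>k = 1/2, 3/2, \<dots>\<close>, of which the quotient is the
  closed form for \<open>r \<noteq> s\<close>.
\<close>
definition q_bessel_kernel :: "real \<Rightarrow> real \<Rightarrow> real \<Rightarrow> real \<Rightarrow> real" where
  "q_bessel_kernel \<xi> q r s =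
     (let J = (\<lambda>\<nu>. hahn_exton \<nu> (2 * \<xi>) q) in
      if r = s then
        q powr ((r + s) / 2) * (\<Sum>j. q powr (real j + 1/2) * J (r + (real j + 1/2)) * J (s + (real j + 1/2)))
      else
        \<xi> * (J (r + 1/2) * J (s - 1/2) - J (r - 1/2) * J (s + 1/2)) /
          (q powr ((r - s) / 2) - q powr (- (r - s) / 2)))"

text \<open>
  The integral over the imaginary axis converges only conditionally, so it is taken as the
  limit over the segments from \<open>-\<i>R\<close> to \<open>\<i>R\<close>. Its value is real.
\<close>
definition airy :: "real \<Rightarrow> real" where
  "airy x = Re (1 / (2 * of_real pi * \<i>) *
     Lim at_top (\<lambda>R::real. contour_integral (linepath (- (\<i> * of_real R)) (\<i> * of_real R))
                             (\<lambda>z. exp (z ^ 3 / 3 - of_real x * z))))"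

definition airy_kernel :: "real \<Rightarrow> real \<Rightarrow> real" where
  "airy_kernel x y = integral {0..} (\<lambda>z. airy (x + z) * airy (y + z))"

end

theory Submission
  imports Defs "HOL-Probability.Distributions" "HOL-Real_Asymp.Real_Asymp"
begin

text \<open>
  Write \<open>q = exp (- \<epsilon>)\<close> with \<open>\<epsilon> = \<beta>\<^sub>0 h\<^sup>3\<close>, so that \<open>1 / h\<close> is the scaling factor. The generating function of
  \<open>J\<^sub>n\<close> at \<open>e\<^sup>u\<close> equals \<open>exp (\<Phi> u) / (1 - \<xi> e\<^bsup>-u\<^esup>)\<close> with the odd function
  \<open>\<Phi> u = 2 \<Sum>\<^sub>m \<xi>\<^sup>m sinh (m u) / (m (1 - q\<^sup>m))\<close>, and \<open>1 / (1 - q\<^sup>m) = 1 / (m \<epsilon>) + O(1)\<close> yields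
  \<open>\<Phi> u = \<alpha>\<^sub>0 u / \<epsilon> + \<beta>\<^sub>0 u\<^sup>3 / (3 \<epsilon>) + O(\<bar>u\<bar> + \<bar>u\<bar>\<^sup>5 / \<epsilon>)\<close>. Hence the Cauchy integral for \<open>J\<^sub>n\<close> over
  \<open>u = h (1 + \<i> t)\<close> turns into the Airy integral over \<open>1 + \<i> \<real>\<close>. On this contour
  \<open>Re (\<Phi> (h + \<i> \<theta>)) - \<Phi> h\<close> is a sum of nonpositive terms whose first one alone gives a Gaussian
  majorant, which justifies the limit and shows that \<open>J\<^sub>n / h\<close> decays like \<open>exp (- h (n - \<alpha>\<^sub>0 / \<epsilon>))\<close>.
  The kernel, in the form of its series, is the integral of a step function of mesh \<open>h\<close>, and
  dominated convergence applies once more.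
\<close>

section \<open>Infinite q-Pochhammer symbols\<close>

text \<open>The exponents of the scaling come from a double critical point at \<open>u = 0\<close>:
  an order \<open>n\<close> near \<open>\<alpha>\<^sub>0 / \<epsilon>\<close> cancels the linear
  term of the phase and oddness excludes a quadratic one, so the cubic term decides, and it has size
  one exactly when \<open>u\<close> has size \<open>h\<close>. The cubic expansion holds only for
  small \<open>u\<close>, whereas the contour runs up to \<open>\<bar>t\<bar> = pi / h\<close>. It
  is therefore used at fixed \<open>t\<close>, for the limit, and at \<open>t = 0\<close>, for the
  size; the range in between is left to the sign of the real part. The quotient form of the kernel
  is unsuited to the limit: its numerator is a difference of products whose leading orders cancel,
  so that asymptotics of differences of \<open>J\<close> would be required, and it degenerates on
  the diagonal. The series needs only the asymptotics of \<open>J\<close> itself and a bound uniform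
  in the order.\<close>

lemma qpoch_tendsto_qpoch_inf:
  fixes a q :: "'a::{real_normed_field,banach}"
  assumes "norm q < 1"
  shows "qpoch a q \<longlonglongrightarrow> qpoch_inf a q"
proof -
  have "summable (\<lambda>k. norm ((1 - a * q ^ k) - 1))"
    using assms by (auto simp: norm_mult norm_power intro!: summable_mult summable_geometric)
  then have "convergent_prod (\<lambda>k. 1 - a * q ^ k)"
    by (intro abs_convergent_prod_imp_convergent_prod summable_imp_abs_convergent_prod)
  then have "(\<lambda>n. \<Prod>k\<le>n. 1 - a * q ^ k) \<longlonglongrightarrow> qpoch_inf a q"
    unfolding qpoch_inf_def by (rule convergent_prod_LIMSEQ)
  then have "(\<lambda>n. qpoch a q (Suc n)) \<longlonglongrightarrow> qpoch_inf a q"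
    by (simp add: qpoch_def lessThan_Suc_atMost)
  then show ?thesis by (rule LIMSEQ_imp_Suc)
qed

text \<open>All product formulas below are obtained by iterating the functional equation \<open>E a = (1 - a) E (q a)\<close>.\<close>

lemma qpoch_inf_eqI:
  fixes a q :: "'a::{real_normed_field,banach}" and E :: "'a \<Rightarrow> 'a"
  assumes q: "norm q < 1"
    and step: "\<And>n. E (a * q ^ n) = (1 - a * q ^ n) * E (a * q ^ Suc n)"
    and cont: "isCont E 0" and E0: "E 0 = 1"
  shows "qpoch_inf a q = E a"
proof -
  have eq: "E a = qpoch a q n * E (a * q ^ n)" for n
    by (induction n) (simp_all add: qpoch_def step mult.assoc)
  have "(\<lambda>n. a * q ^ n) \<longlonglongrightarrow> 0"
    using q by (intro tendsto_mult_right_zero LIMSEQ_power_zero)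
  then have "(\<lambda>n. E (a * q ^ n)) \<longlonglongrightarrow> 1"
    using cont E0 isCont_tendsto_compose by fastforce
  then have "(\<lambda>n. qpoch a q n * E (a * q ^ n)) \<longlonglongrightarrow> qpoch_inf a q * 1"
    by (intro tendsto_mult qpoch_tendsto_qpoch_inf q)
  then have "(\<lambda>n. E a) \<longlonglongrightarrow> qpoch_inf a q" by (simp flip: eq)
  then show ?thesis by (simp add: LIMSEQ_const_iff)
qed

section \<open>Euler's power series for the infinite product and its reciprocal\<close>

lemma qpoch_self_Suc: "qpoch q q (Suc k) = qpoch q q k * (1 - q ^ Suc k)"
  by (simp add: qpoch_def)

lemma qpoch_self_nonzero:
  fixes q :: real
  assumes "0 < q" "q < 1"
  shows "qpoch q q k \<noteq> 0"
proof -
  have "1 - q * q ^ j \<noteq> 0" for j using power_Suc_less_one[of q j] assms by simp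
  then show ?thesis by (simp add: qpoch_def)
qed

text \<open>Coefficients of Euler's two expansions in powers of \<open>a\<close>: those of
  \<open>1 / qpoch_inf a q\<close> here, those of \<open>qpoch_inf a q\<close> in
  \<open>euler_coeff'\<close>.\<close>

definition euler_coeff :: "real \<Rightarrow> nat \<Rightarrow> real" where
  "euler_coeff q k = 1 / qpoch q q k"

definition euler_coeff' :: "real \<Rightarrow> nat \<Rightarrow> real" where
  "euler_coeff' q k = (-1) ^ k * q ^ (k * (k - 1) div 2) / qpoch q q k"

lemma euler_coeff_Suc:
  assumes "0 < q" "q < 1"
  shows "euler_coeff q (Suc k) * (1 - q ^ Suc k) = euler_coeff q k"
  using qpoch_self_nonzero[OF assms, of "Suc k"]
  unfolding euler_coeff_def qpoch_self_Suc by (simp del: power_Suc)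

lemma euler_coeff'_Suc:
  assumes "0 < q" "q < 1"
  shows "euler_coeff' q (Suc k) * (1 - q ^ Suc k) = - (q ^ k) * euler_coeff' q k"
proof -
  have "Suc k * k div 2 = k * (k - 1) div 2 + k"
  proof (cases k)
    case (Suc m)
    have "Suc k * k = k * (k - 1) + k * 2" by (simp add: Suc algebra_simps)
    then show ?thesis by (metis div_mult_self1 add.commute numeral_neq_zero)
  qed auto
  then have e: "q ^ (Suc k * k div 2) = q ^ (k * (k - 1) div 2) * q ^ k"
    by (simp add: power_add)
  have n: "1 - q ^ Suc k \<noteq> 0" "qpoch q q k \<noteq> 0"
    using qpoch_self_nonzero[OF assms] qpoch_self_nonzero[OF assms, of "Suc k"]
    unfolding qpoch_self_Suc by auto
  show ?thesis
    unfolding euler_coeff'_def qpoch_self_Suc diff_Suc_1 e using n by (simp del: power_Suc) simp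
qed

text \<open>The ratios met below may exceed 1 for small indices and only their limit is controlled,
  so the ratio test starts where they have dropped below a fixed \<open>c < 1\<close>.\<close>

lemma summable_ratio_limit:
  fixes f :: "nat \<Rightarrow> 'a::banach"
  assumes lim: "r \<longlonglongrightarrow> L" and L: "L < 1" and f: "\<And>n. norm (f (Suc n)) \<le> r n * norm (f n)"
  shows "summable (\<lambda>n. norm (f n))"
proof -
  obtain c where c: "L < c" "c < 1" using L dense by blast
  then have "eventually (\<lambda>n. r n < c) sequentially" using lim order_tendstoD(2) by blast
  then obtain N where N: "\<And>n. n \<ge> N \<Longrightarrow> r n < c" by (auto simp: eventually_sequentially)
  show ?thesis
  proof (rule summable_ratio_test[OF c(2), of N])
    fix n assume "N \<le> n"
    then show "norm (norm (f (Suc n))) \<le> c * norm (norm (f n))"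
      using f[of n] mult_right_mono[OF less_imp_le[OF N[of n]] norm_ge_zero[of "f n"]] by simp
  qed
qed

lemma summable_euler:
  fixes a :: complex
  assumes q: "0 < q" "q < 1" and a: "norm a < 1"
  shows "summable (\<lambda>k. norm (of_real (euler_coeff q k) * a ^ k))"
proof (rule summable_ratio_limit)
  have "(\<lambda>k. q ^ Suc k) \<longlonglongrightarrow> 0"
    using q by (intro LIMSEQ_Suc LIMSEQ_power_zero) auto
  then have "(\<lambda>k. norm a / (1 - q ^ Suc k)) \<longlonglongrightarrow> norm a / (1 - 0)"
    by (intro tendsto_intros) auto
  then show "(\<lambda>k. norm a / (1 - q ^ Suc k)) \<longlonglongrightarrow> norm a" by simp
next
  fix k
  have p: "1 - q ^ Suc k > 0" using q power_Suc_less_one[of q k] by simp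
  have "euler_coeff q (Suc k) = euler_coeff q k / (1 - q ^ Suc k)"
    using euler_coeff_Suc[OF q, of k] p by (simp add: field_simps)
  then show "norm (of_real (euler_coeff q (Suc k)) * a ^ Suc k)
      \<le> norm a / (1 - q ^ Suc k) * norm (of_real (euler_coeff q k) * a ^ k)"
    unfolding norm_mult norm_of_real norm_power using p by (simp add: abs_mult mult_ac)
qed (use a in auto)

lemma summable_euler':
  fixes a :: complex
  assumes q: "0 < q" "q < 1"
  shows "summable (\<lambda>k. norm (of_real (euler_coeff' q k) * a ^ k))"
proof (rule summable_ratio_limit)
  have "(\<lambda>k. q ^ Suc k) \<longlonglongrightarrow> 0"
    using q by (intro LIMSEQ_Suc LIMSEQ_power_zero) auto
  moreover have "(\<lambda>k. q ^ k) \<longlonglongrightarrow> 0"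
    using q by (intro LIMSEQ_power_zero) auto
  ultimately have "(\<lambda>k. q ^ k * norm a / (1 - q ^ Suc k)) \<longlonglongrightarrow> 0 * norm a / (1 - 0)"
    by (intro tendsto_divide tendsto_mult tendsto_diff tendsto_const) auto
  then show "(\<lambda>k. q ^ k * norm a / (1 - q ^ Suc k)) \<longlonglongrightarrow> 0" by simp
next
  fix k
  have p: "1 - q ^ Suc k > 0" using q power_Suc_less_one[of q k] by simp
  have "euler_coeff' q (Suc k) = - (q ^ k) * euler_coeff' q k / (1 - q ^ Suc k)"
    using euler_coeff'_Suc[OF q, of k] p by (simp add: field_simps)
  then show "norm (of_real (euler_coeff' q (Suc k)) * a ^ Suc k)
      \<le> q ^ k * norm a / (1 - q ^ Suc k) * norm (of_real (euler_coeff' q k) * a ^ k)"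
    unfolding norm_mult norm_of_real norm_power using p q by (simp add: abs_mult mult_ac)
qed auto

lemma isCont_powser_0:
  fixes c :: "nat \<Rightarrow> 'a::{real_normed_field,banach}"
  assumes "summable (\<lambda>k. norm (c k * K ^ k))" "K \<noteq> 0"
  shows "isCont (\<lambda>a. \<Sum>k. c k * a ^ k) 0"
  using isCont_powser[OF summable_norm_cancel[OF assms(1)], of 0] assms(2) by simp

text \<open>Replacing \<open>a\<close> by \<open>b * a\<close> multiplies the k-th coefficient by
  \<open>b ^ k\<close>. The difference loses its constant term, and a recurrence for the
  coefficients becomes a functional equation for the sum.\<close>

lemma suminf_shift_power:
  fixes c :: "nat \<Rightarrow> 'a::{real_normed_field,banach}"
  assumes "summable (\<lambda>k. c k * a ^ k)" "summable (\<lambda>k. c k * (b * a) ^ k)"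
    and d: "\<And>k. c (Suc k) * (1 - b ^ Suc k) = d k"
  shows "(\<Sum>k. c k * a ^ k) - (\<Sum>k. c k * (b * a) ^ k) = (\<Sum>k. d k * a ^ Suc k)"
proof -
  have eq: "c k * a ^ k - c k * (b * a) ^ k = c k * (1 - b ^ k) * a ^ k" for k
    by (simp add: power_mult_distrib algebra_simps)
  have s: "summable (\<lambda>k. c k * (1 - b ^ k) * a ^ k)"
    using summable_diff[OF assms(1,2)] by (simp only: eq)
  have "(\<Sum>k. c k * a ^ k) - (\<Sum>k. c k * (b * a) ^ k) = (\<Sum>k. c k * (1 - b ^ k) * a ^ k)"
    unfolding suminf_diff[OF assms(1,2)] eq ..
  also have "\<dots> = (\<Sum>k. c (Suc k) * (1 - b ^ Suc k) * a ^ Suc k)"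
    using suminf_split_head[OF s] by simp
  finally show ?thesis by (simp only: d)
qed

text \<open>The recurrence of the coefficients gives \<open>e b * (1 - b) = e (q * b)\<close>, the
  functional equation of the reciprocal product; hence \<open>inverse (e a)\<close> is what is
  compared with \<open>qpoch_inf\<close>.\<close>

lemma qpoch_inf_eq_euler:
  fixes a :: complex
  assumes q: "0 < q" "q < 1" and a: "norm a < 1"
  shows "1 / qpoch_inf a (of_real q) = (\<Sum>k. of_real (euler_coeff q k) * a ^ k)"
proof -
  define e where "e a = (\<Sum>k. of_real (euler_coeff q k) * a ^ k)" for a :: complex
  have e: "e b * (1 - b) = e (of_real q * b)" if "norm b < 1" for b
  proof -
    have "q * norm b \<le> 1 * norm b" using q by (intro mult_right_mono) auto
    then have nb: "norm (of_real q * b) < 1" using q that by (simp add: norm_mult)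
    note s = summable_norm_cancel[OF summable_euler[OF q that]]
      summable_norm_cancel[OF summable_euler[OF q nb]]
    have "e b - e (of_real q * b) = (\<Sum>k. of_real (euler_coeff q k) * b ^ Suc k)"
      unfolding e_def
      by (intro suminf_shift_power s) (metis euler_coeff_Suc[OF q] of_real_1 of_real_diff of_real_mult of_real_power)
    also have "\<dots> = b * e b"
      unfolding e_def by (subst suminf_mult[symmetric]) (use s in \<open>auto simp: mult_ac\<close>)
    finally show ?thesis by (simp add: algebra_simps)
  qed
  have "qpoch_inf a (of_real q) = inverse (e a)"
  proof (rule qpoch_inf_eqI)
    fix n
    have "norm (a * of_real q ^ n) \<le> norm a"
      using q by (simp add: norm_mult norm_power mult_left_le power_le_one)
    then have n1: "norm (a * of_real q ^ n) < 1" using a by linarith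
    then have "1 - a * of_real q ^ n \<noteq> 0" by auto
    moreover have "e (a * of_real q ^ Suc n) = e (a * of_real q ^ n) * (1 - a * of_real q ^ n)"
      using e[OF n1] by (simp add: mult_ac)
    ultimately show "inverse (e (a * of_real q ^ n))
        = (1 - a * of_real q ^ n) * inverse (e (a * of_real q ^ Suc n))"
      by simp
  next
    have "isCont e 0"
      unfolding e_def by (rule isCont_powser_0[OF summable_euler[OF q, of "1/2"]]) auto
    moreover show E0: "inverse (e 0) = 1"
      unfolding e_def by (subst powser_zero) (simp add: euler_coeff_def qpoch_def)
    ultimately show "isCont (\<lambda>a. inverse (e a)) 0"
      by (intro continuous_intros) auto
  qed (use q in auto)
  then show ?thesis by (simp add: e_def inverse_eq_divide)
qed

lemma qpoch_inf_eq_euler':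
  fixes a :: complex
  assumes q: "0 < q" "q < 1"
  shows "qpoch_inf a (of_real q) = (\<Sum>k. of_real (euler_coeff' q k) * a ^ k)"
proof -
  define e where "e a = (\<Sum>k. of_real (euler_coeff' q k) * a ^ k)" for a :: complex
  note s = summable_norm_cancel[OF summable_euler'[OF q]]
  have e: "e b = (1 - b) * e (of_real q * b)" for b
  proof -
    have "e b - e (of_real q * b) = (\<Sum>k. (- (of_real q ^ k) * of_real (euler_coeff' q k)) * b ^ Suc k)"
      unfolding e_def
      by (intro suminf_shift_power s) (metis euler_coeff'_Suc[OF q] of_real_1 of_real_diff of_real_mult of_real_power of_real_minus)
    also have "\<dots> = (\<Sum>k. - b * (of_real (euler_coeff' q k) * (of_real q * b) ^ k))"
      by (simp add: power_mult_distrib mult_ac)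
    also have "\<dots> = - b * e (of_real q * b)"
      unfolding e_def by (rule suminf_mult[OF s])
    finally show ?thesis by (simp add: algebra_simps)
  qed
  have "qpoch_inf a (of_real q) = e a"
  proof (rule qpoch_inf_eqI)
    fix n
    show "e (a * of_real q ^ n) = (1 - a * of_real q ^ n) * e (a * of_real q ^ Suc n)"
      using e[of "a * of_real q ^ n"] by (simp add: mult_ac)
  next
    show "isCont e 0"
      unfolding e_def by (rule isCont_powser_0[OF summable_euler'[OF q, of "1/2"]]) auto
    show "e 0 = 1"
      unfolding e_def by (subst powser_zero) (simp add: euler_coeff'_def qpoch_def)
  qed (use q in auto)
  then show ?thesis by (simp add: e_def)
qed

text \<open>Expanding each \<open>- ln (1 - a * q ^ k)\<close> in powers of \<open>a\<close> and
  summing the geometric series over \<open>k\<close> gives these coefficients. At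
  \<open>m = 0\<close> division by zero yields 0, so the series effectively start at
  \<open>m = 1\<close>.\<close>

definition qlog_coeff :: "real \<Rightarrow> nat \<Rightarrow> real" where
  "qlog_coeff q m = 1 / (real m * (1 - q ^ m))"

lemma summable_qlog:
  fixes a :: complex
  assumes q: "0 < q" "q < 1" and a: "norm a < 1"
  shows "summable (\<lambda>m. norm (of_real (qlog_coeff q m) * a ^ m))"
proof (rule summable_comparison_test')
  show "summable (\<lambda>m. 1 / (1 - q) * norm a ^ m)"
    using a by (intro summable_mult summable_geometric) auto
  fix m :: nat assume m: "m \<ge> 1"
  then have "1 - q ^ m \<ge> 1 - q" "real m \<ge> 1" using q power_decreasing[of 1 m q] by auto
  then have "1 * (1 - q) \<le> real m * (1 - q ^ m)" using q by (intro mult_mono) auto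
  then have "\<bar>qlog_coeff q m\<bar> \<le> 1 / (1 - q)"
    using q unfolding qlog_coeff_def by (auto simp: abs_if intro!: divide_left_mono)
  then show "norm (norm (of_real (qlog_coeff q m) * a ^ m)) \<le> 1 / (1 - q) * norm a ^ m"
    unfolding norm_mult norm_of_real norm_power by (simp add: mult_right_mono del: times_divide_eq_left)
qed

text \<open>Exponentiating the functional equation avoids choosing a branch for the logarithm of the
  infinite product; only the principal logarithm of \<open>1 - b\<close> on the unit disc
  enters.\<close>

lemma qpoch_inf_eq_exp:
  fixes a :: complex
  assumes q: "0 < q" "q < 1" and a: "norm a < 1"
  shows "qpoch_inf a (of_real q) = exp (- (\<Sum>m. of_real (qlog_coeff q m) * a ^ m))"
proof -
  define g where "g a = (\<Sum>m. of_real (qlog_coeff q m) * a ^ m)" for a :: complex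
  have g: "exp (- g b) = (1 - b) * exp (- g (of_real q * b))" if b: "norm b < 1" for b
  proof -
    have "q * norm b \<le> 1 * norm b" using q by (intro mult_right_mono) auto
    then have nb: "norm (of_real q * b) < 1" using q that by (simp add: norm_mult)
    note s = summable_norm_cancel[OF summable_qlog[OF q that]]
      summable_norm_cancel[OF summable_qlog[OF q nb]]
    have "g b - g (of_real q * b) = (\<Sum>k. (1 / of_nat (Suc k)) * b ^ Suc k)"
      unfolding g_def
    proof (intro suminf_shift_power s)
      fix k
      have "1 - q ^ Suc k \<noteq> 0" using q power_Suc_less_one[of q k] by simp
      then have "qlog_coeff q (Suc k) * (1 - q ^ Suc k) = 1 / real (Suc k)"
        by (simp add: qlog_coeff_def)
      from arg_cong[OF this, of complex_of_real]
      show "complex_of_real (qlog_coeff q (Suc k)) * (1 - of_real q ^ Suc k) = 1 / of_nat (Suc k)"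
        by (simp del: power_Suc of_nat_Suc)
    qed
    also have "\<dots> = - ln (1 - b)"
    proof -
      have "(\<lambda>n. - (1 / of_nat n * b ^ n)) sums ln (1 - b)"
        using Ln_series'[of "- b"] b by simp
      then have "(\<lambda>n. 1 / of_nat n * b ^ n) sums - ln (1 - b)" using sums_minus by fastforce
      then have "(\<lambda>n. 1 / of_nat (Suc n) * b ^ Suc n) sums - ln (1 - b)"
        by (subst sums_Suc_iff) simp
      then show ?thesis by (rule sums_unique[symmetric])
    qed
    finally have "- g b = ln (1 - b) + - g (of_real q * b)" by (simp add: algebra_simps)
    moreover have "1 - b \<noteq> 0" using b by auto
    ultimately show ?thesis by (simp only: exp_add exp_Ln not_False_eq_True)
  qed
  have "qpoch_inf a (of_real q) = exp (- g a)"
  proof (rule qpoch_inf_eqI)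
    fix n
    have "norm (a * of_real q ^ n) \<le> norm a"
      using q by (simp add: norm_mult norm_power mult_left_le power_le_one)
    then have n1: "norm (a * of_real q ^ n) < 1" using a by linarith
    show "exp (- g (a * of_real q ^ n)) = (1 - a * of_real q ^ n) * exp (- g (a * of_real q ^ Suc n))"
      using g[OF n1] by (simp add: mult_ac)
  next
    have "isCont g 0"
      unfolding g_def by (rule isCont_powser_0[OF summable_qlog[OF q, of "1/2"]]) auto
    then show "isCont (\<lambda>a. exp (- g a)) 0" by (intro continuous_intros)
    show "exp (- g 0) = 1"
      unfolding g_def by (subst powser_zero) (simp add: qlog_coeff_def)
  qed (use q in auto)
  then show ?thesis by (simp add: g_def)
qed

section \<open>Laurent coefficients of the generating function\<close>

lemma has_integral_cis:
  fixes h :: real and k :: int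
  assumes "h > 0"
  shows "((\<lambda>t. cis (of_int k * (h * t))) has_integral (if k = 0 then 2 * pi / h else 0)) {-pi/h..pi/h}"
proof (cases "k = 0")
  case True
  have "((\<lambda>t. 1 :: complex) has_integral (pi / h - (- pi / h)) *\<^sub>R 1) {-pi/h..pi/h}"
    using assms by (intro has_integral_const_real[THEN has_integral_eq_rhs]) (auto simp: divide_simps)
  then show ?thesis using True by (simp add: scaleR_conv_of_real)
next
  case False
  define F where "F t = cis (of_int k * (h * t)) / (\<i> * of_int k * of_real h)" for t :: real
  have ii: "- (\<i> * (a * (\<i> * c))) = a * c" for a c
  proof -
    have "\<i> * (a * (\<i> * c)) = (\<i> * \<i>) * (a * c)" by (simp only: mult_ac)
    then show ?thesis by simp
  qed
  have "((\<lambda>t. cis (of_int k * (h * t))) has_integral (F (pi/h) - F (-pi/h))) {-pi/h..pi/h}"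
  proof (rule fundamental_theorem_of_calculus)
    show "-pi/h \<le> pi/h" using assms by (simp add: divide_simps)
    fix t
    show "(F has_vector_derivative cis (of_int k * (h * t))) (at t within {-pi/h..pi/h})"
      unfolding F_def has_vector_derivative_def using False assms
      by (auto intro!: derivative_eq_intros simp: scaleR_conv_of_real fun_eq_iff divide_simps)
        (simp only: ii)
  qed
  moreover have "F (pi/h) = F (-pi/h)"
  proof -
    have "cis (of_int k * pi) = cis (- (of_int k * pi))"
      by (simp add: complex_eq_iff sin_times_pi_eq_0)
    then show ?thesis using assms by (simp add: F_def)
  qed
  ultimately show ?thesis using False by simp
qed

text \<open>Unconditional summability of complex families is absolute, so the series converges
  uniformly and may be integrated termwise. The scale \<open>h\<close> anticipates the substitution
  \<open>\<theta> = h * t\<close>; continuity of \<open>f\<close> is recorded for the passage to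
  Lebesgue integrals.\<close>

lemma fourier_coeff:
  fixes C :: "int \<Rightarrow> complex" and h :: real
  assumes h: "h > 0" and S: "\<And>t. ((\<lambda>m. C m * cis (of_int m * (h * t))) has_sum f t) UNIV"
  shows "((\<lambda>t. f t * cis (- of_int n * (h * t))) has_integral (2 * pi / h * C n)) {-pi/h..pi/h}"
    and "continuous_on {-pi/h..pi/h} f"
proof -
  have "C summable_on UNIV" using has_sum_imp_summable[OF S[of 0]] by simp
  then have abs: "(\<lambda>m. norm (C m)) summable_on UNIV"
    by (simp add: summable_on_iff_abs_summable_on_complex)
  define u where "u m t = C m * cis (of_int (m - n) * (h * t))" for m and t :: real
  have u: "C m * cis (of_int m * (h * t)) * cis (- of_int n * (h * t)) = u m t" for m t
    by (simp add: u_def cis_mult mult.assoc algebra_simps)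
  have lim: "uniform_limit {-pi/h..pi/h} (\<lambda>X t. \<Sum>m\<in>X. u m t)
    (\<lambda>t. f t * cis (- of_int n * (h * t))) (finite_subsets_at_top UNIV)"
  proof (rule Weierstrass_m_test_general'[OF _ _ abs])
    show "((\<lambda>m. u m t) has_sum (f t * cis (- of_int n * (h * t)))) UNIV" for t
      using has_sum_cmult_left[OF S[of t], of "cis (- of_int n * (h * t))"] by (simp only: u)
  qed (auto simp: u_def norm_mult)
  have cont: "continuous_on {-pi/h..pi/h} (\<lambda>t. \<Sum>m\<in>X. u m t)" for X
    unfolding u_def by (intro continuous_intros)
  obtain I J where I: "\<And>X. ((\<lambda>t. \<Sum>m\<in>X. u m t) has_integral I X) {-pi/h..pi/h}"
    and J: "((\<lambda>t. f t * cis (- of_int n * (h * t))) has_integral J) {-pi/h..pi/h}"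
    and IJ: "(I \<longlongrightarrow> J) (finite_subsets_at_top UNIV)"
    by (rule uniform_limit_integral[OF lim cont]) (auto simp: finite_subsets_at_top_neq_bot)
  \<comment> \<open>By orthogonality the integral of a partial sum is exact as soon as its index set
    contains \<open>n\<close>, so the net \<open>I\<close> is eventually constant.\<close>
  have "I X = 2 * pi / h * C n" if "finite X" "n \<in> X" for X
  proof (rule has_integral_unique[OF I])
    have "((\<lambda>t. \<Sum>m\<in>X. u m t) has_integral (\<Sum>m\<in>X. C m * (if m - n = 0 then 2 * pi / h else 0))) {-pi/h..pi/h}"
      unfolding u_def by (intro has_integral_sum that has_integral_mult_right has_integral_cis[OF h])
    also have "(\<Sum>m\<in>X. C m * (if m - n = 0 then 2 * pi / h else 0)) = (\<Sum>m\<in>X. if m = n then C n * (2 * pi / h) else 0)"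
      by (intro sum.cong) auto
    also have "\<dots> = 2 * pi / h * C n" using that by simp
    finally show "((\<lambda>t. \<Sum>m\<in>X. u m t) has_integral 2 * pi / h * C n) {-pi/h..pi/h}" .
  qed
  then have "eventually (\<lambda>X. I X = 2 * pi / h * C n) (finite_subsets_at_top UNIV)"
    unfolding eventually_finite_subsets_at_top by (intro exI[of _ "{n}"]) auto
  then have "(I \<longlongrightarrow> 2 * pi / h * C n) (finite_subsets_at_top UNIV)"
    by (rule tendsto_eventually)
  then have "J = 2 * pi / h * C n"
    using IJ by (intro tendsto_unique) (auto simp: finite_subsets_at_top_neq_bot)
  then show "((\<lambda>t. f t * cis (- of_int n * (h * t))) has_integral (2 * pi / h * C n)) {-pi/h..pi/h}"
    using J by simp
  have "continuous_on {-pi/h..pi/h} (\<lambda>t. f t * cis (- of_int n * (h * t)))"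
    by (rule uniform_limit_theorem[OF _ lim])
      (use cont in \<open>auto intro!: always_eventually simp: finite_subsets_at_top_neq_bot\<close>)
  then have "continuous_on {-pi/h..pi/h} (\<lambda>t. f t * cis (- of_int n * (h * t)) * cis (of_int n * (h * t)))"
    by (rule continuous_on_mult) (intro continuous_intros)
  then show "continuous_on {-pi/h..pi/h} f" by (simp add: mult.assoc cis_mult)
qed

text \<open>Serves twice: it makes the definite description in \<open>hahn_exton_int\<close> well
  defined, the unit circle lying inside the annulus, and it lets the recurrence be read off by
  comparing coefficients.\<close>

lemma laurent_unit_circle_unique:
  fixes C D :: "int \<Rightarrow> complex"
  assumes "\<And>z. norm z = 1 \<Longrightarrow> ((\<lambda>m. C m * z powi m) has_sum f z) UNIV"
    and "\<And>z. norm z = 1 \<Longrightarrow> ((\<lambda>m. D m * z powi m) has_sum f z) UNIV"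
  shows "C = D"
proof
  fix n
  have p: "cis t powi m = cis (of_int m * (1 * t))" for t m by (simp add: cis_power_int)
  have "((\<lambda>m. C m * cis (of_int m * (1 * t))) has_sum f (cis t)) UNIV"
    "((\<lambda>m. D m * cis (of_int m * (1 * t))) has_sum f (cis t)) UNIV" for t
    using assms[of "cis t"] unfolding p by auto
  note C = fourier_coeff(1)[OF zero_less_one this(1), of n] and D = fourier_coeff(1)[OF zero_less_one this(2), of n]
  from has_integral_unique[OF C D] show "C n = D n" by simp
qed

definition hahn_exton_gf :: "real \<Rightarrow> real \<Rightarrow> complex \<Rightarrow> complex" where
  "hahn_exton_gf \<xi> q z = qpoch_inf (of_real (q * \<xi>) / z) (of_real q) / qpoch_inf (of_real \<xi> * z) (of_real q)"

lemma has_sum_mult_Times: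
  fixes a :: "'i \<Rightarrow> complex" and b :: "'j \<Rightarrow> complex"
  assumes a: "(a has_sum A) X" and b: "(b has_sum B) Y"
  shows "((\<lambda>p. a (fst p) * b (snd p)) has_sum A * B) (X \<times> Y)"
proof (rule has_sum_SigmaI)
  show "((\<lambda>k. a (fst (j, k)) * b (snd (j, k))) has_sum a j * B) Y" for j
    unfolding fst_conv snd_conv by (rule has_sum_cmult_right[OF b])
  show "((\<lambda>j. a j * B) has_sum A * B) X" by (rule has_sum_cmult_left[OF a])
  have na: "(\<lambda>j. norm (a j)) summable_on X" and nb: "(\<lambda>k. norm (b k)) summable_on Y"
    by (rule iffD1[OF summable_on_iff_abs_summable_on_complex] has_sum_imp_summable a b)+
  have "(\<lambda>p. norm (a (fst p)) * norm (b (snd p))) summable_on (X \<times> Y)"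
  proof (rule summable_on_SigmaI)
    show "((\<lambda>k. norm (a (fst (j, k))) * norm (b (snd (j, k)))) has_sum
        norm (a j) * infsum (\<lambda>k. norm (b k)) Y) Y" for j
      unfolding fst_conv snd_conv by (intro has_sum_cmult_right has_sum_infsum nb)
    show "(\<lambda>j. norm (a j) * infsum (\<lambda>k. norm (b k)) Y) summable_on X"
      by (intro summable_on_cmult_left na)
  qed auto
  then have "(\<lambda>p. norm (a (fst p) * b (snd p))) summable_on (X \<times> Y)"
    by (simp only: norm_mult)
  then show "(\<lambda>p. a (fst p) * b (snd p)) summable_on (X \<times> Y)"
    by (rule abs_summable_summable)
qed

text \<open>Multiply the two Euler series and collect the index pairs \<open>(j, k)\<close> with
  \<open>j - k = m\<close>; absolute convergence of the double series justifies the
  regrouping.\<close>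

lemma hahn_exton_gf_laurent_ex:
  assumes q: "0 < q" "q < 1" and \<xi>: "\<bar>\<xi>\<bar> < 1"
  shows "\<exists>c :: int \<Rightarrow> real. \<forall>z. z \<noteq> 0 \<and> norm (of_real \<xi> * z) < 1 \<longrightarrow>
    ((\<lambda>m. of_real (c m) * z powi m) has_sum hahn_exton_gf \<xi> q z) UNIV"
proof -
  define t where "t p = euler_coeff q (fst p) * \<xi> ^ fst p * (euler_coeff' q (snd p) * (q * \<xi>) ^ snd p)" for p
  define S where "S m = {p. int (fst p) - int (snd p) = m}" for m
  have prod: "((\<lambda>p. of_real (t p) * z powi (int (fst p) - int (snd p))) has_sum hahn_exton_gf \<xi> q z) UNIV"
    if z0: "z \<noteq> 0" and z: "norm (of_real \<xi> * z) < 1" for z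
  proof -
    define a where "a j = of_real (euler_coeff q j) * (of_real \<xi> * z) ^ j" for j
    define b where "b k = of_real (euler_coeff' q k) * (of_real (q * \<xi>) / z) ^ k" for k
    have T: "a (fst p) * b (snd p) = of_real (t p) * z powi (int (fst p) - int (snd p))" for p
      using z0 by (simp add: a_def b_def t_def power_mult_distrib power_divide power_int_diff)
    have sa: "summable (\<lambda>j. norm (a j))" unfolding a_def by (rule summable_euler[OF q z])
    have sb: "summable (\<lambda>k. norm (b k))" unfolding b_def by (rule summable_euler'[OF q])
    have "a sums (1 / qpoch_inf (of_real \<xi> * z) (of_real q))"
      using summable_sums[OF summable_norm_cancel[OF sa]] qpoch_inf_eq_euler[OF q z] by (simp add: a_def[abs_def])
    then have ha: "(a has_sum 1 / qpoch_inf (of_real \<xi> * z) (of_real q)) UNIV"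
      by (rule norm_summable_imp_has_sum[OF sa])
    have "b sums qpoch_inf (of_real (q * \<xi>) / z) (of_real q)"
      using summable_sums[OF summable_norm_cancel[OF sb]] qpoch_inf_eq_euler'[OF q] by (simp add: b_def[abs_def])
    then have hb: "(b has_sum qpoch_inf (of_real (q * \<xi>) / z) (of_real q)) UNIV"
      by (rule norm_summable_imp_has_sum[OF sb])
    have "1 / qpoch_inf (of_real \<xi> * z) (of_real q) * qpoch_inf (of_real (q * \<xi>) / z) (of_real q)
        = hahn_exton_gf \<xi> q z"
      by (simp add: hahn_exton_gf_def)
    then show ?thesis using has_sum_mult_Times[OF ha hb] by (simp only: T UNIV_Times_UNIV)
  qed
  \<comment> \<open>The point \<open>z = 1\<close> lies in the annulus and removes the powers of
    \<open>z\<close>: the real weights \<open>t\<close> are summable, so the regrouped coefficients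
    are real and independent of \<open>z\<close>.\<close>
  have "(\<lambda>p. complex_of_real (t p)) summable_on UNIV"
    using has_sum_imp_summable[OF prod[of 1]] \<xi> by simp
  then have "(\<lambda>p. norm (complex_of_real (t p))) summable_on UNIV"
    by (rule iffD1[OF summable_on_iff_abs_summable_on_complex])
  then have "(\<lambda>p. norm (t p)) summable_on UNIV" by simp
  then have "t summable_on UNIV" by (rule abs_summable_summable)
  then have tS: "(t has_sum infsum t (S m)) (S m)" for m
    by (rule has_sum_infsum[OF summable_on_subset_banach[OF _ subset_UNIV]])
  have "((\<lambda>m. of_real (infsum t (S m)) * z powi m) has_sum hahn_exton_gf \<xi> q z) UNIV"
    if z: "z \<noteq> 0" "norm (of_real \<xi> * z) < 1" for z
  proof (rule has_sum_Sigma')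
    let ?f = "\<lambda>x. of_real (t (snd x)) * z powi (fst x)"
    have bij: "bij_betw (\<lambda>p. (int (fst p) - int (snd p), p)) UNIV (Sigma UNIV S)"
      by (rule bij_betw_byWitness[of _ snd]) (auto simp: S_def)
    show "(?f has_sum hahn_exton_gf \<xi> q z) (Sigma UNIV S)"
      by (rule iffD1[OF has_sum_reindex_bij_betw[OF bij]]) (use prod[OF z] in simp)
    show "((\<lambda>p. ?f (m, p)) has_sum of_real (infsum t (S m)) * z powi m) (S m)" for m
      unfolding fst_conv snd_conv by (rule has_sum_cmult_left[OF has_sum_of_real[OF tS]])
  qed
  then show ?thesis by (intro exI[of _ "\<lambda>m. infsum t (S m)"]) simp
qed

lemma hahn_exton_int_has_sum:
  assumes q: "0 < q" "q < 1" and \<xi>: "\<bar>\<xi>\<bar> < 1" and z: "z \<noteq> 0" "norm (of_real \<xi> * z) < 1"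
  shows "((\<lambda>m. of_real (hahn_exton_int m (2 * \<xi>) q) * z powi m) has_sum hahn_exton_gf \<xi> q z) UNIV"
proof -
  define P where "P c \<longleftrightarrow> (\<forall>z. z \<noteq> 0 \<and> norm (of_real \<xi> * z) < 1 \<longrightarrow>
    ((\<lambda>m. of_real (c m) * z powi m) has_sum hahn_exton_gf \<xi> q z) UNIV)" for c :: "int \<Rightarrow> real"
  define c0 where "c0 = (THE c. P c)"
  have eq: "hahn_exton_int m (2 * \<xi>) q = c0 m" for m
    by (simp add: hahn_exton_int_def c0_def P_def hahn_exton_gf_def)
  obtain c where c: "P c" using hahn_exton_gf_laurent_ex[OF q \<xi>] unfolding P_def by blast
  have "P c0"
    unfolding c0_def
  proof (rule theI[of P, OF c])
    fix d assume d: "P d"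
    have "(\<lambda>m. complex_of_real (d m)) = (\<lambda>m. complex_of_real (c m))"
    proof (rule laurent_unit_circle_unique)
      fix z :: complex assume "norm z = 1"
      then have "z \<noteq> 0" "norm (of_real \<xi> * z) < 1" using \<xi> by (auto simp: norm_mult)
      then show "((\<lambda>m. of_real (d m) * z powi m) has_sum hahn_exton_gf \<xi> q z) UNIV"
        "((\<lambda>m. of_real (c m) * z powi m) has_sum hahn_exton_gf \<xi> q z) UNIV"
        using c d unfolding P_def by auto
    qed
    then show "d = c" by (simp add: fun_eq_iff)
  qed
  then show ?thesis using z unfolding eq P_def by blast
qed

section \<open>The phase function\<close>

lemma qpoch_inf_step:
  fixes a q :: "'a::{real_normed_field,banach}"
  assumes "norm q < 1"
  shows "qpoch_inf a q = (1 - a) * qpoch_inf (q * a) q"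
proof -
  have "qpoch a q (Suc n) = (1 - a) * qpoch (q * a) q n" for n
    unfolding qpoch_def by (subst prod.lessThan_Suc_shift) (simp add: mult_ac)
  moreover have "(\<lambda>n. qpoch a q (Suc n)) \<longlonglongrightarrow> qpoch_inf a q"
    by (intro LIMSEQ_Suc qpoch_tendsto_qpoch_inf assms)
  moreover have "(\<lambda>n. (1 - a) * qpoch (q * a) q n) \<longlonglongrightarrow> (1 - a) * qpoch_inf (q * a) q"
    by (intro tendsto_intros qpoch_tendsto_qpoch_inf assms)
  ultimately show ?thesis by (simp add: LIMSEQ_unique)
qed

definition gf_phase :: "real \<Rightarrow> real \<Rightarrow> complex \<Rightarrow> complex" where
  "gf_phase \<xi> q u = (\<Sum>m. of_real (qlog_coeff q m * \<xi> ^ m) * (exp (of_nat m * u) - exp (- (of_nat m * u))))"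

lemma gf_phase_sums:
  assumes q: "0 < q" "q < 1" and \<xi>: "0 < \<xi>" "\<xi> * exp \<bar>Re u\<bar> < 1"
  shows "(\<lambda>m. of_real (qlog_coeff q m * \<xi> ^ m) * (exp (of_nat m * u) - exp (- (of_nat m * u)))) sums
      ((\<Sum>m. of_real (qlog_coeff q m) * (of_real \<xi> * exp u) ^ m)
        - (\<Sum>m. of_real (qlog_coeff q m) * (of_real \<xi> * exp (- u)) ^ m))" (is "?f sums ?S")
    and "norm (of_real \<xi> * exp u) < 1" "norm (of_real \<xi> * exp (- u)) < 1"
proof -
  have "\<xi> * exp (Re u) \<le> \<xi> * exp \<bar>Re u\<bar>" "\<xi> * exp (- Re u) \<le> \<xi> * exp \<bar>Re u\<bar>"
    using \<xi> by auto
  then have "\<xi> * exp (Re u) < 1" "\<xi> * exp (- Re u) < 1" using \<xi>(2) by linarith+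
  then show n: "norm (of_real \<xi> * exp u) < 1" "norm (of_real \<xi> * exp (- u)) < 1"
    using \<xi> by (auto simp: norm_mult)
  have "(\<lambda>m. of_real (qlog_coeff q m) * (of_real \<xi> * exp u) ^ m
      - of_real (qlog_coeff q m) * (of_real \<xi> * exp (- u)) ^ m) sums ?S"
    by (intro sums_diff summable_sums summable_norm_cancel[OF summable_qlog[OF q n(1)]]
        summable_norm_cancel[OF summable_qlog[OF q n(2)]])
  moreover have "of_real (qlog_coeff q m) * (of_real \<xi> * exp u) ^ m
      - of_real (qlog_coeff q m) * (of_real \<xi> * exp (- u)) ^ m = ?f m" for m
    by (simp add: power_mult_distrib exp_of_nat_mult[symmetric] algebra_simps)
  ultimately show "?f sums ?S" by simp
qed

text \<open>Completing the product at \<open>q * \<xi> / z\<close> to the one at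
  \<open>\<xi> / z\<close> costs the factor \<open>1 - \<xi> / z\<close>, but leaves a quotient that
  is inverted when \<open>z\<close> is replaced by \<open>1 / z\<close>; this is why its logarithm
  is odd in \<open>u\<close>.\<close>

lemma hahn_exton_gf_exp:
  assumes q: "0 < q" "q < 1" and \<xi>: "0 < \<xi>" "\<xi> * exp \<bar>Re u\<bar> < 1"
  shows "hahn_exton_gf \<xi> q (exp u) = exp (gf_phase \<xi> q u) / (1 - of_real \<xi> * exp (- u))"
proof -
  note P = gf_phase_sums[OF q \<xi>]
  let ?a = "of_real \<xi> * exp (- u)"
  have a1: "1 - ?a \<noteq> 0" using P(3) by auto
  have e: "of_real (q * \<xi>) / exp u = of_real q * ?a" by (simp add: exp_minus divide_inverse mult_ac)
  have "qpoch_inf ?a (of_real q) = (1 - ?a) * qpoch_inf (of_real q * ?a) (of_real q)"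
    using q by (intro qpoch_inf_step) auto
  then have "qpoch_inf (of_real (q * \<xi>) / exp u) (of_real q) = qpoch_inf ?a (of_real q) / (1 - ?a)"
    unfolding e using a1 by (metis nonzero_mult_div_cancel_left)
  then have "hahn_exton_gf \<xi> q (exp u)
      = qpoch_inf ?a (of_real q) / qpoch_inf (of_real \<xi> * exp u) (of_real q) / (1 - ?a)"
    by (simp add: hahn_exton_gf_def)
  also have "qpoch_inf ?a (of_real q) / qpoch_inf (of_real \<xi> * exp u) (of_real q) = exp (gf_phase \<xi> q u)"
    unfolding qpoch_inf_eq_exp[OF q P(2)] qpoch_inf_eq_exp[OF q P(3)] gf_phase_def
      sums_unique[OF P(1), symmetric] by (simp flip: exp_diff)
  finally show ?thesis .
qed

section \<open>Cubic expansion of the phase with explicit error\<close>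

lemma expm1_inverse_bounds:
  fixes x :: real
  assumes "x > 0"
  shows "\<bar>1 / (1 - exp (- x)) - 1 / x\<bar> \<le> 1"
proof -
  have e: "exp (- x) < 1" using assms by simp
  have "1 - exp (- x) \<le> x" using exp_ge_add_one_self[of "- x"] by simp
  then have "1 / x \<le> 1 / (1 - exp (- x))" using e assms by (intro divide_left_mono) auto
  moreover have "1 / (1 - exp (- x)) \<le> 1 + 1 / x"
  proof -
    have "(1 + x) * exp (- x) \<le> exp x * exp (- x)"
      by (intro mult_right_mono exp_ge_add_one_self) auto
    also have "\<dots> = 1" by (simp flip: exp_add)
    finally have "(1 + x) * (1 - exp (- x)) \<ge> x" by (simp add: algebra_simps)
    then show ?thesis using e assms by (simp add: field_simps)
  qed
  ultimately show ?thesis by simp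
qed

lemma norm_two_sinh_le:
  fixes v :: complex
  shows "norm (exp v - exp (- v)) \<le> 2 * norm v * exp (norm v)"
proof -
  have 1: "norm (exp w - 1) \<le> norm w * exp (norm w)" for w :: complex
    using Taylor_exp_field[of w 0] by (simp add: mult.commute)
  have "norm (exp v - exp (- v)) = norm ((exp v - 1) - (exp (- v) - 1))" by simp
  also have "\<dots> \<le> norm (exp v - 1) + norm (exp (- v) - 1)" by (rule norm_triangle_ineq4)
  also have "\<dots> \<le> norm v * exp (norm v) + norm v * exp (norm v)"
    using 1[of v] 1[of "- v"] by (intro add_mono) auto
  finally show ?thesis by simp
qed

text \<open>The Taylor polynomials of degree 4 at \<open>v\<close> and \<open>- v\<close> share
  their even terms, so the error after the cubic term is already of fifth order.\<close>

lemma norm_two_sinh_taylor: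
  fixes v :: complex
  shows "norm (exp v - exp (- v) - (2 * v + v ^ 3 / 3)) \<le> norm v ^ 5 * exp (norm v)"
proof -
  have T: "norm (exp w - (1 + w + w ^ 2 / 2 + w ^ 3 / 6 + w ^ 4 / 24)) \<le> exp (norm w) * norm w ^ 5 / 24"
    for w :: complex
    using Taylor_exp_field[of w 4] by (simp add: eval_nat_numeral fact_numeral add_ac)
  have "exp v - exp (- v) - (2 * v + v ^ 3 / 3)
      = (exp v - (1 + v + v ^ 2 / 2 + v ^ 3 / 6 + v ^ 4 / 24))
        - (exp (- v) - (1 + (- v) + (- v) ^ 2 / 2 + (- v) ^ 3 / 6 + (- v) ^ 4 / 24))"
    by (simp add: field_simps)
  also have "norm \<dots> \<le> exp (norm v) * norm v ^ 5 / 24 + exp (norm v) * norm v ^ 5 / 24"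
    by (rule order_trans[OF norm_triangle_ineq4 add_mono[OF T[of v] T[of "- v", unfolded norm_minus_cancel]]])
  also have "\<dots> \<le> norm v ^ 5 * exp (norm v)"
    using zero_le_mult_iff[of "exp (norm v)" "norm v ^ 5"] by (simp add: mult.commute)
  finally show ?thesis .
qed

text \<open>Origin of the two constants: the m-th term of the phase is close to \<open>\<xi> ^ m /
  (m ^ 2 * \<epsilon>) * (2 * m * u + m ^ 3 * u ^ 3 / 3)\<close>, whose linear and cubic parts lead
  to this series and to the one in \<open>sums_beta\<close>. The summand at \<open>m = 0\<close> is
  a division by zero, hence 0.\<close>

lemma sums_alpha:
  fixes \<xi> :: real
  assumes "\<bar>\<xi>\<bar> < 1"
  shows "(\<lambda>m. 2 * \<xi> ^ m / m) sums (- 2 * ln (1 - \<xi>))"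
proof -
  have "(\<lambda>n. - ((- (- \<xi>)) ^ n) / of_nat n) sums ln (1 + (- \<xi>))"
    using assms by (intro ln_series') auto
  from sums_mult[OF this, of "- 2"] show ?thesis by simp
qed

lemma sums_beta:
  fixes \<xi> :: real
  assumes "\<bar>\<xi>\<bar> < 1"
  shows "(\<lambda>m. m * \<xi> ^ m) sums (\<xi> / (1 - \<xi>)\<^sup>2)"
proof -
  have "(\<lambda>n. \<xi> * (of_nat (Suc n) * \<xi> ^ n)) sums (\<xi> * (1 / (1 - \<xi>)\<^sup>2))"
    using assms by (intro sums_mult geometric_deriv_sums) auto
  then have "(\<lambda>n. real (Suc n) * \<xi> ^ Suc n) sums (\<xi> / (1 - \<xi>)\<^sup>2)"
    by (simp add: algebra_simps)
  then show ?thesis by (subst (asm) sums_Suc_iff) simp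
qed

lemma summable_cube_geometric:
  fixes x :: real
  assumes "0 \<le> x" "x < 1"
  shows "summable (\<lambda>m. real m ^ 3 * x ^ m)"
proof -
  have "(\<lambda>m. ((real m + 2) / (real m + 1)) ^ 3 * x) \<longlonglongrightarrow> 1 ^ 3 * x"
    by (intro tendsto_intros) real_asymp
  then have "summable (\<lambda>m. norm ((real (Suc m)) ^ 3 * x ^ m))"
  proof (rule summable_ratio_limit)
    fix m
    have "(real (Suc (Suc m))) = (real m + 2) / (real m + 1) * (real (Suc m))"
      using of_nat_0_le_iff[of m, where ?'a = real] by (simp add: field_simps)
    then have "(real (Suc (Suc m))) ^ 3 = ((real m + 2) / (real m + 1)) ^ 3 * (real (Suc m)) ^ 3"
      by (metis power_mult_distrib)
    then show "norm (real (Suc (Suc m)) ^ 3 * x ^ Suc m)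
      \<le> ((real m + 2) / (real m + 1)) ^ 3 * x * norm (real (Suc m) ^ 3 * x ^ m)"
      using assms by (simp add: abs_mult)
  qed (use assms in auto)
  then have "summable (\<lambda>m. x * norm ((real (Suc m)) ^ 3 * x ^ m))" by (rule summable_mult)
  then have "summable (\<lambda>m. real (Suc m) ^ 3 * x ^ Suc m)"
    using assms by (simp add: abs_mult mult_ac)
  then show ?thesis by (subst (asm) summable_Suc_iff)
qed

text \<open>Two errors per term: replacing \<open>1 / (1 - q ^ m)\<close> by
  \<open>1 / (m * \<epsilon>)\<close> changes that factor by at most 1, whatever \<open>m\<close>
  is, and truncating the hyperbolic sine costs fifth order. The growth
  \<open>exp (m * norm u)\<close> is absorbed by \<open>\<xi> ^ m\<close> because
  \<open>\<xi> * exp \<delta> < 1\<close>.\<close>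

lemma gf_phase_expansion:
  fixes u :: complex
  assumes \<epsilon>: "\<epsilon> > 0" and \<xi>: "0 < \<xi>" and \<delta>: "\<xi> * exp \<delta> < 1" and u: "norm u \<le> \<delta>"
  shows "norm (gf_phase \<xi> (exp (- \<epsilon>)) u
      - (of_real (- 2 * ln (1 - \<xi>) / \<epsilon>) * u + of_real (\<xi> / (1 - \<xi>)\<^sup>2 / (3 * \<epsilon>)) * u ^ 3))
    \<le> (2 * norm u + norm u ^ 5 / \<epsilon>) * (\<Sum>m. real m ^ 3 * (\<xi> * exp \<delta>) ^ m)"
proof -
  let ?q = "exp (- \<epsilon>)"
  have d0: "0 \<le> \<delta>" using u norm_ge_zero order_trans by blast
  have "\<xi> \<le> \<xi> * exp \<delta>" using mult_left_mono[of 1 "exp \<delta>" \<xi>] d0 \<xi> by simp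
  then have \<xi>1: "\<bar>\<xi>\<bar> < 1" using \<delta> \<xi> by linarith
  have "\<xi> * exp \<bar>Re u\<bar> \<le> \<xi> * exp \<delta>"
    using \<xi> u abs_Re_le_cmod[of u] by (intro mult_left_mono) auto
  then have R: "\<xi> * exp \<bar>Re u\<bar> < 1" using \<delta> by simp
  have q: "0 < ?q" "?q < 1" using \<epsilon> by auto
  define x where "x m = of_real (qlog_coeff ?q m * \<xi> ^ m) * (exp (of_nat m * u) - exp (- (of_nat m * u)))" for m
  define y where "y m = of_real (2 * \<xi> ^ m / m) * (u / of_real \<epsilon>) + of_real (m * \<xi> ^ m) * (u ^ 3 / of_real (3 * \<epsilon>))" for m :: nat
  have "x sums gf_phase \<xi> ?q u"
    using gf_phase_sums(1)[OF q \<xi> R] unfolding gf_phase_def x_def by (simp add: sums_iff)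
  moreover have "y sums (of_real (- 2 * ln (1 - \<xi>)) * (u / of_real \<epsilon>) + of_real (\<xi> / (1 - \<xi>)\<^sup>2) * (u ^ 3 / of_real (3 * \<epsilon>)))"
    unfolding y_def using sums_alpha[OF \<xi>1] sums_beta[OF \<xi>1]
    by (intro sums_add sums_mult2) (auto simp only: sums_of_real_iff)
  ultimately have S: "(\<lambda>m. x m - y m) sums (gf_phase \<xi> ?q u
      - (of_real (- 2 * ln (1 - \<xi>)) * (u / of_real \<epsilon>) + of_real (\<xi> / (1 - \<xi>)\<^sup>2) * (u ^ 3 / of_real (3 * \<epsilon>))))"
    by (rule sums_diff)
  let ?K = "2 * norm u + norm u ^ 5 / \<epsilon>"
  have bound: "norm (x m - y m) \<le> ?K * (real m ^ 3 * (\<xi> * exp \<delta>) ^ m)" for m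
  proof (cases "m = 0")
    case True
    then show ?thesis by (simp add: x_def y_def)
  next
    case False
    define v where "v = of_nat m * u"
    define S where "S = exp v - exp (- v)"
    define c where "c = 1 / (1 - exp (- (m * \<epsilon>))) - 1 / (m * \<epsilon>)"
    have m1: "1 \<le> real m" using False by simp
    have c: "\<bar>c\<bar> \<le> 1" unfolding c_def using False \<epsilon> by (intro expm1_inverse_bounds) auto
    have qm: "?q ^ m = exp (- (m * \<epsilon>))" by (simp flip: exp_of_nat_mult)
    have qc: "qlog_coeff ?q m = (c + 1 / (m * \<epsilon>)) / m"
      unfolding qlog_coeff_def qm c_def by simp
    have "x m - y m = of_real (\<xi> ^ m / m) * (of_real c * S + (S - (2 * v + v ^ 3 / 3)) / of_real (m * \<epsilon>))"
      unfolding x_def y_def qc S_def v_def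
      using False \<epsilon> by (simp add: field_simps power2_eq_square power3_eq_cube)
    also have "norm \<dots> \<le> \<xi> ^ m / m * (1 * (2 * norm v * exp (norm v)) + norm v ^ 5 * exp (norm v) / (m * \<epsilon>))"
      unfolding norm_mult
    proof (intro mult_mono norm_triangle_le)
      show "norm (complex_of_real (\<xi> ^ m / real m)) \<le> \<xi> ^ m / real m"
        unfolding norm_of_real using \<xi> by simp
      have "norm (of_real c * S) \<le> 1 * (2 * norm v * exp (norm v))"
        unfolding norm_mult S_def norm_of_real using c by (intro mult_mono norm_two_sinh_le) auto
      moreover have "norm ((S - (2 * v + v ^ 3 / 3)) / of_real (m * \<epsilon>)) \<le> norm v ^ 5 * exp (norm v) / (m * \<epsilon>)"
        unfolding norm_divide S_def norm_of_real using \<epsilon> norm_two_sinh_taylor[of v]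
        by (simp add: divide_right_mono)
      ultimately show "norm (of_real c * S) + norm ((S - (2 * v + v ^ 3 / 3)) / of_real (m * \<epsilon>))
         \<le> 1 * (2 * norm v * exp (norm v)) + norm v ^ 5 * exp (norm v) / (m * \<epsilon>)" by (rule add_mono)
    qed (use \<xi> in auto)
    \<comment> \<open>Of the factor \<open>m ^ 5\<close> in the Taylor tail, the denominators
      \<open>m\<close> and \<open>m * \<epsilon>\<close> cancel two powers; this is the source of
      \<open>m ^ 3\<close> in the majorant.\<close>
    also have "\<dots> = \<xi> ^ m * exp (norm v) * (2 * norm u + real m ^ 3 * norm u ^ 5 / \<epsilon>)"
      unfolding v_def norm_mult norm_of_nat using False \<epsilon>
      by (simp add: field_simps eval_nat_numeral)
    also have "\<dots> \<le> \<xi> ^ m * exp (m * \<delta>) * (?K * real m ^ 3)"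
    proof (intro mult_mono)
      have "1 \<le> real m ^ 3" using m1 by (rule one_le_power)
      then have "2 * norm u * 1 \<le> 2 * norm u * real m ^ 3" by (intro mult_left_mono) auto
      then show "2 * norm u + real m ^ 3 * norm u ^ 5 / \<epsilon> \<le> ?K * real m ^ 3"
        by (simp add: algebra_simps)
      show "exp (norm v) \<le> exp (m * \<delta>)" using u by (simp add: v_def norm_mult mult_left_mono)
    qed (use \<xi> \<epsilon> in auto)
    also have "\<dots> = ?K * (real m ^ 3 * (\<xi> * exp \<delta>) ^ m)"
      by (simp add: power_mult_distrib exp_of_nat_mult)
    finally show ?thesis .
  qed
  have sK: "(\<lambda>m. ?K * (real m ^ 3 * (\<xi> * exp \<delta>) ^ m)) sums (?K * (\<Sum>m. real m ^ 3 * (\<xi> * exp \<delta>) ^ m))"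
    using \<xi> \<delta> by (intro sums_mult summable_sums summable_cube_geometric) auto
  have "norm (\<Sum>m. x m - y m) \<le> (\<Sum>m. ?K * (real m ^ 3 * (\<xi> * exp \<delta>) ^ m))"
    by (rule norm_suminf_le[OF bound sums_summable[OF sK]])
  then show ?thesis
    unfolding sums_unique[OF S, symmetric] sums_unique[OF sK, symmetric] by simp
qed

section \<open>Gaussian decay of the phase in the angle\<close>

lemma one_minus_cos_ge:
  fixes \<theta> :: real
  assumes "\<bar>\<theta>\<bar> \<le> pi"
  shows "1 - cos \<theta> \<ge> \<theta>\<^sup>2 / 18"
proof -
  define x where "x = \<bar>\<theta>\<bar> / 2"
  have x: "0 \<le> x" "x \<le> 2" using assms pi_less_4 by (auto simp: x_def)
  have "\<bar>sin x - x\<bar> \<le> x ^ 3 / 6"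
  proof -
    have fact3: "fact 3 = (6 :: real)" by (simp add: fact_numeral)
    have "(\<Sum>m<3. sin_coeff m * x ^ m) = x"
      by (simp add: numeral_3_eq_3 sin_coeff_def)
    then show ?thesis
      using Maclaurin_sin_bound[of x 3] x(1) by (simp add: numeral_3_eq_3[symmetric] fact3)
  qed
  then have "x - x ^ 3 / 6 \<le> sin x" by linarith
  \<comment> \<open>For \<open>x \<le> 2\<close> this turns the cubic lower bound into
    \<open>sin x \<ge> x / 3\<close>; with \<open>x = \<bar>\<theta>\<bar> / 2\<close> the identity
    \<open>1 - cos \<theta> = 2 * (sin x)\<^sup>2\<close> then produces the constant 18.\<close>
  moreover have "x ^ 3 / 6 \<le> x * (2 / 3)"
  proof -
    have "x * x\<^sup>2 \<le> x * 2\<^sup>2" using x by (intro mult_left_mono power_mono) auto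
    then show ?thesis by (simp add: power3_eq_cube power2_eq_square)
  qed
  ultimately have "x / 3 \<le> sin x" by linarith
  then have "(x / 3)\<^sup>2 \<le> (sin x)\<^sup>2" using x by (intro power_mono) auto
  moreover have "cos \<theta> = 1 - 2 * (sin x)\<^sup>2"
    using cos_double_sin[of x] by (simp add: x_def)
  ultimately show ?thesis by (simp add: x_def power2_eq_square)
qed

text \<open>
  Every term of \<open>\<Phi> h - Re (\<Phi> (h + \<i> \<theta>))\<close> is nonnegative; only the one for \<open>m = 1\<close> is kept.
\<close>

lemma Re_gf_phase_le:
  assumes \<epsilon>: "\<epsilon> > 0" and \<xi>: "0 < \<xi>" and h: "0 < h" "\<xi> * exp h < 1" and \<theta>: "\<bar>\<theta>\<bar> \<le> pi"
  shows "Re (gf_phase \<xi> (exp (- \<epsilon>)) (Complex h \<theta>))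
    \<le> Re (gf_phase \<xi> (exp (- \<epsilon>)) (of_real h)) - \<xi> * h / (9 * \<epsilon>) * \<theta>\<^sup>2"
proof -
  let ?q = "exp (- \<epsilon>)"
  have q: "0 < ?q" "?q < 1" using \<epsilon> by auto
  define w where "w m = qlog_coeff ?q m * \<xi> ^ m * (exp (m * h) - exp (- (m * h)))" for m :: nat
  have w0: "w m \<ge> 0" for m
  proof -
    have "qlog_coeff ?q m \<ge> 0" using q by (simp add: qlog_coeff_def power_le_one)
    moreover have "exp (m * h) - exp (- (m * h)) \<ge> 0" using h by simp
    ultimately show ?thesis using \<xi> by (simp add: w_def)
  qed
  \<comment> \<open>At \<open>u = h + \<i> \<phi>\<close> the real part of
    \<open>exp (m * u) - exp (- (m * u))\<close> is the same expression at \<open>h\<close> times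
    \<open>cos (m * \<phi>)\<close>: a nonnegative weight times a cosine.\<close>
  have Re: "(\<lambda>m. w m * cos (real m * \<phi>)) sums Re (gf_phase \<xi> ?q (Complex h \<phi>))" for \<phi>
  proof -
    have "(\<lambda>m. of_real (qlog_coeff ?q m * \<xi> ^ m) *
        (exp (of_nat m * Complex h \<phi>) - exp (- (of_nat m * Complex h \<phi>)))) sums gf_phase \<xi> ?q (Complex h \<phi>)"
      using gf_phase_sums(1)[OF q \<xi>, of "Complex h \<phi>"] h unfolding gf_phase_def by (simp add: sums_iff)
    from sums_Re[OF this] show ?thesis
      unfolding w_def by (simp add: Re_exp algebra_simps)
  qed
  have "(\<lambda>m. w m * cos (real m * 0) - w m * cos (real m * \<theta>)) sums
      (Re (gf_phase \<xi> ?q (Complex h 0)) - Re (gf_phase \<xi> ?q (Complex h \<theta>)))"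
    by (intro sums_diff Re)
  moreover have "w m * cos (real m * 0) - w m * cos (real m * \<theta>) = w m * (1 - cos (real m * \<theta>))" for m
    by (simp add: algebra_simps)
  ultimately have S: "(\<lambda>m. w m * (1 - cos (real m * \<theta>))) sums
      (Re (gf_phase \<xi> ?q (Complex h 0)) - Re (gf_phase \<xi> ?q (Complex h \<theta>)))" by simp
  have "sum (\<lambda>m. w m * (1 - cos (real m * \<theta>))) {1} \<le> (\<Sum>m. w m * (1 - cos (real m * \<theta>)))"
    using w0 by (intro sum_le_suminf sums_summable[OF S]) auto
  then have *: "w 1 * (1 - cos \<theta>) \<le> Re (gf_phase \<xi> ?q (of_real h)) - Re (gf_phase \<xi> ?q (Complex h \<theta>))"
    using sums_unique[OF S] by (simp add: complex_of_real_def)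
  \<comment> \<open>Uses \<open>1 - q \<le> \<epsilon>\<close> and
    \<open>exp h - exp (- h) \<ge> 2 * h\<close>. Combined with the 1/18 of the cosine estimate it
    gives the rate \<open>\<xi> * h / (9 * \<epsilon>)\<close>.\<close>
  have "1 / \<epsilon> * \<xi> * (2 * h) \<le> w 1"
  proof -
    have "1 - ?q \<le> \<epsilon>" using exp_ge_add_one_self[of "- \<epsilon>"] by simp
    then have "1 / \<epsilon> \<le> qlog_coeff ?q 1" using q \<epsilon> by (simp add: qlog_coeff_def divide_left_mono)
    moreover have "2 * h \<le> exp h - exp (- h)"
      using real_le_x_sinh[of h] h by (simp add: exp_minus)
    moreover have "0 \<le> qlog_coeff ?q 1" using q by (simp add: qlog_coeff_def)
    ultimately have "1 / \<epsilon> * \<xi> * (2 * h) \<le> qlog_coeff ?q 1 * \<xi> * (exp h - exp (- h))"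
      using \<xi> h by (intro mult_mono mult_nonneg_nonneg) auto
    then show ?thesis by (simp add: w_def)
  qed
  then have "1 / \<epsilon> * \<xi> * (2 * h) * (\<theta>\<^sup>2 / 18) \<le> w 1 * (1 - cos \<theta>)"
    using w0 by (intro mult_mono one_minus_cos_ge \<theta>) auto
  moreover have "1 / \<epsilon> * \<xi> * (2 * h) * (\<theta>\<^sup>2 / 18) = \<xi> * h / (9 * \<epsilon>) * \<theta>\<^sup>2" by simp
  ultimately show ?thesis using * by linarith
qed

section \<open>The Airy function\<close>

lemma integrable_exp_neg_square:
  fixes \<kappa> :: real
  assumes "\<kappa> > 0"
  shows "integrable lborel (\<lambda>t. exp (- \<kappa> * t\<^sup>2))"
proof -
  define \<sigma> where "\<sigma> = 1 / sqrt (2 * \<kappa>)"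
  have s: "2 * \<sigma>\<^sup>2 = 1 / \<kappa>" using assms by (simp add: \<sigma>_def power_divide)
  have s0: "\<sigma> > 0" using assms by (simp add: \<sigma>_def)
  have "integrable lborel (\<lambda>t. sqrt (2 * pi * \<sigma>\<^sup>2) * normal_density 0 \<sigma> t)"
    by (intro integrable_mult_right integrable_normal_density s0)
  also have "(\<lambda>t. sqrt (2 * pi * \<sigma>\<^sup>2) * normal_density 0 \<sigma> t) = (\<lambda>t. exp (- \<kappa> * t\<^sup>2))"
    using s0 by (simp add: normal_density_def s fun_eq_iff)
  finally show ?thesis .
qed

lemma lborel_integral_Icc:
  fixes f :: "real \<Rightarrow> 'a::euclidean_space"
  assumes "continuous_on {a..b} f" "(f has_integral I) {a..b}"
  shows "integrable lborel (\<lambda>t. indicator {a..b} t *\<^sub>R f t)"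
    and "(LINT t|lborel. indicator {a..b} t *\<^sub>R f t) = I"
proof -
  have s: "set_integrable lborel {a..b} f" by (rule borel_integrable_atLeastAtMost'[OF assms(1)])
  then show "integrable lborel (\<lambda>t. indicator {a..b} t *\<^sub>R f t)" by (simp add: set_integrable_def)
  show "(LINT t|lborel. indicator {a..b} t *\<^sub>R f t) = I"
    using set_borel_integral_eq_integral(2)[OF s] integral_unique[OF assms(2)]
    by (simp add: set_lebesgue_integral_def)
qed

text \<open>The Airy integrand at \<open>1 + \<i> t\<close>; the factor \<i> from \<open>dz\<close>
  cancels the one in the prefactor of \<open>airy\<close>. Its modulus is Gaussian since the real
  part of the cubic term is \<open>1 / 3 - t\<^sup>2\<close>, while on the imaginary axis the
  modulus is constant.\<close>

definition airy_integrand :: "real \<Rightarrow> real \<Rightarrow> complex" where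
  "airy_integrand x t = exp (Complex 1 t ^ 3 / 3 - of_real x * Complex 1 t)"

lemma continuous_on_Complex [continuous_intros]:
  assumes "continuous_on S f" "continuous_on S g"
  shows "continuous_on S (\<lambda>x. Complex (f x) (g x))"
  unfolding Complex_eq using assms by (intro continuous_intros)

lemma norm_airy_integrand: "norm (airy_integrand x t) = exp (1 / 3 - x) * exp (- 1 * t\<^sup>2)"
proof -
  have "Re (Complex 1 t ^ 3) = 1 - 3 * t\<^sup>2"
    by (simp add: power3_eq_cube power2_eq_square)
  then show ?thesis
    by (simp add: airy_integrand_def exp_add[symmetric] Re_divide_numeral diff_divide_distrib)
qed

lemma integrable_airy_integrand: "integrable lborel (airy_integrand x)"
proof (rule Bochner_Integration.integrable_bound)
  show "integrable lborel (\<lambda>t. exp (1 / 3 - x) * exp (- 1 * t\<^sup>2))"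
    by (intro integrable_mult_right integrable_exp_neg_square) simp
  have "continuous_on UNIV (airy_integrand x)"
    unfolding airy_integrand_def by (intro continuous_intros) auto
  then show "airy_integrand x \<in> borel_measurable lborel"
    by (simp add: borel_measurable_continuous_onI)
qed (simp add: norm_airy_integrand)

text \<open>
  The contour is moved from \<open>\<i> \<real>\<close> to \<open>1 + \<i> \<real>\<close>, where the integral converges absolutely.
\<close>

lemma airy_eq_integral: "airy x = Re (integral\<^sup>L lborel (airy_integrand x)) / (2 * pi)"
proof -
  define f where "f z = exp (z ^ 3 / 3 - of_real x * z)" for z :: complex
  define L where "L = integral\<^sup>L lborel (airy_integrand x)"
  have "f holomorphic_on UNIV" unfolding f_def by (intro holomorphic_intros) auto
  \<comment> \<open>With a global primitive every segment integral is a difference of values of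
    \<open>P\<close>, and Cauchy's theorem for the rectangle reduces to the cancellation in
    \<open>I\<close>.\<close>
  then obtain P where P: "\<And>z. (P has_field_derivative f z) (at z)"
    using holomorphic_convex_primitive'[of UNIV f] by auto
  have cP: "(f has_contour_integral (P b - P a)) (linepath a b)" for a b
    using contour_integral_primitive[of UNIV P f "linepath a b"] P by auto
  define H where "H R = P (Complex 1 R) - P (Complex 0 R)" for R
  define V where "V R = P (Complex 1 R) - P (Complex 1 (- R))" for R
  have I: "contour_integral (linepath (- (\<i> * of_real R)) (\<i> * of_real R)) f = V R - H R + H (- R)" for R
  proof -
    have "\<i> * of_real R = Complex 0 R" "- (\<i> * of_real R) = Complex 0 (- R)"
      by (simp_all add: complex_eq_iff)
    then show ?thesis using contour_integral_unique[OF cP] by (simp add: V_def H_def)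
  qed
  \<comment> \<open>On a horizontal side the real part of \<open>z ^ 3 / 3\<close> is
    \<open>s ^ 3 / 3 - R\<^sup>2 * s\<close>; integrating the resulting majorant
    \<open>exp (- (R\<^sup>2 * s))\<close> over \<open>s\<close> yields the decay
    \<open>1 / R\<^sup>2\<close>.\<close>
  have H: "norm (H R) \<le> exp (1 / 3 + \<bar>x\<bar>) * (1 / R\<^sup>2)" if R: "R \<noteq> 0" for R
  proof -
    have *: "((\<lambda>s. f (Complex s R)) has_integral H R) {0..1}"
    proof -
      have "linepath (Complex 0 R) (Complex 1 R) s = Complex s R" for s
        by (simp add: linepath_def complex_eq_iff algebra_simps)
      moreover have "Complex 1 R - Complex 0 R = 1" by (simp add: complex_eq_iff)
      ultimately show ?thesis
        using cP[where a = "Complex 0 R" and b = "Complex 1 R"] unfolding has_contour_integral_linepath H_def by simp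
    qed
    have g: "((\<lambda>s. exp (- (R\<^sup>2 * s))) has_integral (- exp (- (R\<^sup>2 * 1)) / R\<^sup>2 - (- exp (- (R\<^sup>2 * 0)) / R\<^sup>2))) {0..1}"
      using R by (intro fundamental_theorem_of_calculus)
        (auto intro!: derivative_eq_intros simp: power2_eq_square simp flip: has_real_derivative_iff_has_vector_derivative)
    have b: "norm (f (Complex s R)) \<le> exp (1 / 3 + \<bar>x\<bar>) * exp (- (R\<^sup>2 * s))" if s: "s \<in> {0..1}" for s
    proof -
      have "Re (Complex s R ^ 3) = s ^ 3 - 3 * (R\<^sup>2 * s)"
        by (simp add: power3_eq_cube power2_eq_square algebra_simps)
      moreover have "s ^ 3 \<le> 1" using s by (simp add: power_le_one)
      moreover have "- (x * s) \<le> \<bar>x\<bar>"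
      proof -
        have "\<bar>x\<bar> * s \<le> \<bar>x\<bar> * 1" using s by (intro mult_left_mono) auto
        then show ?thesis using s abs_ge_minus_self[of "x * s"] by (simp add: abs_mult)
      qed
      ultimately show ?thesis
        by (simp add: f_def exp_add[symmetric] Re_divide_numeral diff_divide_distrib)
    qed
    have "norm (H R) \<le> exp (1 / 3 + \<bar>x\<bar>) * (- exp (- (R\<^sup>2 * 1)) / R\<^sup>2 - (- exp (- (R\<^sup>2 * 0)) / R\<^sup>2))"
      using integral_norm_bound_integral[OF has_integral_integrable[OF *]
          has_integral_integrable[OF has_integral_mult_right[OF g]] b]
      by (simp add: integral_unique[OF *] integral_unique[OF g, simplified])
    also have "\<dots> \<le> exp (1 / 3 + \<bar>x\<bar>) * (1 / R\<^sup>2)"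
      by (intro mult_left_mono) auto
    finally show ?thesis .
  qed
  have lim0: "((\<lambda>R. exp (1 / 3 + \<bar>x\<bar>) * (1 / R\<^sup>2)) \<longlongrightarrow> 0) at_top" by real_asymp
  have H0: "(H \<longlongrightarrow> 0) at_top" "((\<lambda>R. H (- R)) \<longlongrightarrow> 0) at_top"
  proof -
    have ev: "eventually (\<lambda>R::real. R \<noteq> 0) at_top" using eventually_gt_at_top[of 0] by eventually_elim auto
    have "eventually (\<lambda>R. norm (H R) \<le> exp (1 / 3 + \<bar>x\<bar>) * (1 / R\<^sup>2)) at_top"
      using ev by eventually_elim (rule H)
    moreover have "eventually (\<lambda>R. norm (H (- R)) \<le> exp (1 / 3 + \<bar>x\<bar>) * (1 / R\<^sup>2)) at_top"
      using ev by eventually_elim (use H[of "- R" for R] in simp)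
    ultimately show "(H \<longlongrightarrow> 0) at_top" "((\<lambda>R. H (- R)) \<longlongrightarrow> 0) at_top"
      by (blast intro: Lim_null_comparison[OF _ lim0])+
  qed
  have VI: "V R = \<i> * (LINT t|lborel. indicator {- R..R} t *\<^sub>R airy_integrand x t)" if R: "R > 0" for R
  proof -
    have "((\<lambda>t. f (Complex 1 t)) has_integral (- \<i> * V R)) {- R..R}"
      using cP[where a = "Complex 1 (- R)" and b = "Complex 1 R"] R
        has_contour_integral_linepath_same_Re_iff[of "Complex 1 (- R)" 1 "Complex 1 R" "- R" R f "V R"]
      unfolding V_def by simp
    then have "(airy_integrand x has_integral (- \<i> * V R)) {- R..R}"
      by (simp add: f_def airy_integrand_def[abs_def])
    moreover have "continuous_on {- R..R} (airy_integrand x)"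
      unfolding airy_integrand_def by (intro continuous_intros) auto
    ultimately have "- \<i> * V R = (LINT t|lborel. indicator {- R..R} t *\<^sub>R airy_integrand x t)"
      by (metis lborel_integral_Icc(2))
    then have "\<i> * (- \<i> * V R) = \<i> * (LINT t|lborel. indicator {- R..R} t *\<^sub>R airy_integrand x t)"
      by (rule arg_cong)
    then show ?thesis by (simp flip: mult.assoc)
  qed
  have "((\<lambda>R. LINT t|lborel. indicator {- R..R} t *\<^sub>R airy_integrand x t) \<longlongrightarrow> L) at_top"
    unfolding L_def
  proof (rule integral_dominated_convergence_at_top)
    show "integrable lborel (\<lambda>t. norm (airy_integrand x t))"
      using integrable_airy_integrand by simp
    show "AE t in lborel. ((\<lambda>R. indicator {- R..R} t *\<^sub>R airy_integrand x t) \<longlongrightarrow> airy_integrand x t) at_top"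
    proof (intro AE_I2 tendsto_eventually)
      fix t
      show "eventually (\<lambda>R. indicator {- R..R} t *\<^sub>R airy_integrand x t = airy_integrand x t) at_top"
        using eventually_ge_at_top[of "\<bar>t\<bar>"] by eventually_elim (auto simp: indicator_def)
    qed
    show "\<forall>\<^sub>F R in at_top. AE t in lborel. norm (indicator {- R..R} t *\<^sub>R airy_integrand x t) \<le> norm (airy_integrand x t)"
      by (intro always_eventually allI AE_I2) (auto simp: indicator_def)
  qed (use integrable_airy_integrand[of x] in auto)
  then have "((\<lambda>R. \<i> * (LINT t|lborel. indicator {- R..R} t *\<^sub>R airy_integrand x t)) \<longlongrightarrow> \<i> * L) at_top"
    by (intro tendsto_intros)
  moreover have "eventually (\<lambda>R. \<i> * (LINT t|lborel. indicator {- R..R} t *\<^sub>R airy_integrand x t) = V R) at_top"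
    using eventually_gt_at_top[of 0] by eventually_elim (simp add: VI)
  ultimately have "(V \<longlongrightarrow> \<i> * L) at_top" by (rule Lim_transform_eventually)
  then have "((\<lambda>R. V R - H R + H (- R)) \<longlongrightarrow> \<i> * L - 0 + 0) at_top"
    by (intro tendsto_intros H0)
  then have "Lim at_top (\<lambda>R. contour_integral (linepath (- (\<i> * of_real R)) (\<i> * of_real R)) f) = \<i> * L"
    unfolding I by (intro tendsto_Lim) auto
  then have "airy x = Re (1 / (2 * of_real pi * \<i>) * (\<i> * L))"
    unfolding airy_def f_def by simp
  also have "1 / (2 * of_real pi * \<i>) * (\<i> * L) = L / of_real (2 * pi)" by simp
  finally show ?thesis unfolding Re_divide_of_real L_def .
qed

section \<open>Asymptotics of the Hahn--Exton functions\<close>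

definition contour_integrand :: "real \<Rightarrow> real \<Rightarrow> real \<Rightarrow> int \<Rightarrow> real \<Rightarrow> complex" where
  "contour_integrand \<xi> \<epsilon> h n t =
     exp (gf_phase \<xi> (exp (- \<epsilon>)) (of_real h * Complex 1 t) - of_int n * (of_real h * Complex 1 t))
     / (1 - of_real \<xi> * exp (- (of_real h * Complex 1 t)))"

lemma hahn_exton_int_contour:
  assumes \<epsilon>: "\<epsilon> > 0" and \<xi>: "0 < \<xi>" and h: "0 < h" "\<xi> * exp h < 1"
  shows "integrable lborel (\<lambda>t. indicator {-pi/h..pi/h} t *\<^sub>R contour_integrand \<xi> \<epsilon> h n t)"
    and "(LINT t|lborel. indicator {-pi/h..pi/h} t *\<^sub>R contour_integrand \<xi> \<epsilon> h n t)
      = of_real (2 * pi / h * hahn_exton_int n (2 * \<xi>) (exp (- \<epsilon>)))"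
proof -
  let ?q = "exp (- \<epsilon>)"
  let ?u = "\<lambda>t. of_real h * Complex 1 t"
  have q: "0 < ?q" "?q < 1" using \<epsilon> by auto
  have "\<xi> \<le> \<xi> * exp h" using mult_left_mono[of 1 "exp h" \<xi>] h \<xi> by simp
  then have \<xi>1: "\<bar>\<xi>\<bar> < 1" using h \<xi> by linarith
  \<comment> \<open>On the circle of radius \<open>exp h\<close> the Fourier coefficients are the
    Laurent coefficients times \<open>exp (m * h)\<close>; the factor is removed again at
    \<open>m = n\<close>.\<close>
  define C where "C m = complex_of_real (hahn_exton_int m (2 * \<xi>) ?q) * exp (of_int m * of_real h)" for m
  define F where "F t = hahn_exton_gf \<xi> ?q (exp (?u t))" for t
  have cis: "exp (of_int m * of_real h) * cis (of_int m * (h * t)) = exp (of_int m * ?u t)" for m t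
    unfolding cis_conv_exp exp_add[symmetric] by (simp add: Complex_eq algebra_simps)
  have "((\<lambda>m. C m * cis (of_int m * (h * t))) has_sum F t) UNIV" for t
  proof -
    have "((\<lambda>m. of_real (hahn_exton_int m (2 * \<xi>) ?q) * exp (?u t) powi m) has_sum F t) UNIV"
      unfolding F_def using h \<xi> by (intro hahn_exton_int_has_sum q \<xi>1) (auto simp: norm_mult)
    then show ?thesis by (simp add: C_def mult.assoc cis exp_power_int)
  qed
  note four = fourier_coeff[OF h(1) this]
  have G: "contour_integrand \<xi> \<epsilon> h n t = F t * cis (- of_int n * (h * t)) * exp (- of_int n * of_real h)" for t
  proof -
    have F: "F t = exp (gf_phase \<xi> ?q (?u t)) / (1 - of_real \<xi> * exp (- ?u t))"
      unfolding F_def using h \<xi> by (intro hahn_exton_gf_exp q) auto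
    have c: "cis (- of_int n * (h * t)) * exp (- of_int n * of_real h) = exp (- (of_int n * ?u t))"
      using cis[of "- n" t] by (simp add: mult.commute)
    have "F t * cis (- of_int n * (h * t)) * exp (- of_int n * of_real h) = F t * exp (- (of_int n * ?u t))"
      unfolding c[symmetric] by (simp only: mult.assoc)
    then show ?thesis
      unfolding contour_integrand_def F by (auto simp: exp_diff exp_minus divide_inverse mult_ac)
  qed
  have "(contour_integrand \<xi> \<epsilon> h n has_integral (2 * pi / h * C n * exp (- of_int n * of_real h))) {-pi/h..pi/h}"
    unfolding G[abs_def] by (intro has_integral_mult_left four(1))
  moreover have "of_real (2 * pi / h * hahn_exton_int n (2 * \<xi>) ?q) = 2 * pi / h * C n * exp (- of_int n * of_real h)"
    by (simp add: C_def mult.assoc flip: exp_add)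
  ultimately have I: "(contour_integrand \<xi> \<epsilon> h n has_integral of_real (2 * pi / h * hahn_exton_int n (2 * \<xi>) ?q)) {-pi/h..pi/h}"
    by (rule has_integral_eq_rhs)
  have cont: "continuous_on {-pi/h..pi/h} (contour_integrand \<xi> \<epsilon> h n)"
    unfolding G[abs_def] by (intro continuous_intros four(2))
  show "integrable lborel (\<lambda>t. indicator {-pi/h..pi/h} t *\<^sub>R contour_integrand \<xi> \<epsilon> h n t)"
    by (rule lborel_integral_Icc(1)[OF cont I])
  show "(LINT t|lborel. indicator {-pi/h..pi/h} t *\<^sub>R contour_integrand \<xi> \<epsilon> h n t)
      = of_real (2 * pi / h * hahn_exton_int n (2 * \<xi>) ?q)"
    by (rule lborel_integral_Icc(2)[OF cont I])
qed

definition cubic_sum :: "real \<Rightarrow> real" where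
  "cubic_sum x = (\<Sum>m. real m ^ 3 * x ^ m)"

lemma cubic_sum_nonneg: "0 \<le> x \<Longrightarrow> x < 1 \<Longrightarrow> 0 \<le> cubic_sum x"
  unfolding cubic_sum_def by (intro suminf_nonneg summable_cube_geometric) auto

text \<open>Comes from the real point \<open>u = h\<close>: 1/3 is the cubic term there for
  \<open>\<epsilon> = \<beta> * h ^ 3\<close>, the product is the expansion error with
  \<open>h ^ 5 / \<epsilon> = h\<^sup>2 / \<beta>\<close> and \<open>h \<le> \<delta>\<close>, and
  \<open>1 - \<xi>\<close> bounds the denominator of the integrand from below.\<close>

definition contour_bound :: "real \<Rightarrow> real \<Rightarrow> real" where
  "contour_bound \<xi> \<delta> = exp (1 / 3 + (2 * \<delta> + \<delta>\<^sup>2 / (\<xi> / (1 - \<xi>)\<^sup>2)) * cubic_sum (\<xi> * exp \<delta>)) / (1 - \<xi>)"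

text \<open>The expansion enters only at the real point \<open>h\<close>, since
  \<open>h * (1 + \<i> t)\<close> may leave the disc of radius \<delta>; the dependence on
  \<open>t\<close> comes from \<open>Re_gf_phase_le\<close>. For
  \<open>\<epsilon> = \<beta> * h ^ 3\<close> the Gaussian rate becomes
  \<open>(1 - \<xi>)\<^sup>2 / 9\<close>, which is free of \<open>h\<close>.\<close>

lemma norm_contour_integrand_le:
  fixes \<xi> :: real
  defines "\<alpha> \<equiv> - 2 * ln (1 - \<xi>)" and "\<beta> \<equiv> \<xi> / (1 - \<xi>)\<^sup>2"
  assumes \<xi>: "0 < \<xi>" and \<delta>: "\<xi> * exp \<delta> < 1" and h: "0 < h" "h \<le> \<delta>" and t: "\<bar>h * t\<bar> \<le> pi"
  shows "norm (contour_integrand \<xi> (\<beta> * h ^ 3) h n t)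
    \<le> contour_bound \<xi> \<delta> * exp (- ((1 - \<xi>)\<^sup>2 / 9) * t\<^sup>2) * exp (- (h * (n - \<alpha> / (\<beta> * h ^ 3))))"
proof -
  define \<epsilon> where "\<epsilon> = \<beta> * h ^ 3"
  have "\<xi> \<le> \<xi> * exp \<delta>" using mult_left_mono[of 1 "exp \<delta>" \<xi>] h \<xi> by simp
  then have \<xi>1: "\<xi> < 1" using \<delta> \<xi> by linarith
  then have \<beta>: "\<beta> > 0" using \<xi> by (simp add: \<beta>_def)
  have \<epsilon>: "\<epsilon> > 0" using \<beta> h by (simp add: \<epsilon>_def)
  have "\<xi> * exp h \<le> \<xi> * exp \<delta>" using \<xi> h by (intro mult_left_mono) auto
  then have \<xi>h: "\<xi> * exp h < 1" using \<delta> by linarith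
  define P where "P = gf_phase \<xi> (exp (- \<epsilon>))"
  define S where "S = cubic_sum (\<xi> * exp \<delta>)"
  have S0: "S \<ge> 0" unfolding S_def using \<xi> \<delta> by (intro cubic_sum_nonneg) auto
  have u: "of_real h * Complex 1 t = Complex h (h * t)" by (simp add: complex_eq_iff)
  have "Re (P (Complex h (h * t))) \<le> Re (P (of_real h)) - \<xi> * h / (9 * \<epsilon>) * (h * t)\<^sup>2"
    unfolding P_def by (rule Re_gf_phase_le[OF \<epsilon> \<xi> h(1) \<xi>h t])
  also have "\<xi> * h / (9 * \<epsilon>) * (h * t)\<^sup>2 = (1 - \<xi>)\<^sup>2 / 9 * t\<^sup>2"
    using h \<xi> \<xi>1 by (simp add: \<epsilon>_def \<beta>_def field_simps power2_eq_square power3_eq_cube)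
  also have "Re (P (of_real h)) \<le> \<alpha> / \<epsilon> * h + 1 / 3 + (2 * \<delta> + \<delta>\<^sup>2 / \<beta>) * S"
  proof -
    have "Re (P (of_real h)) - (\<alpha> / \<epsilon> * h + \<beta> / (3 * \<epsilon>) * h ^ 3)
        = Re (P (of_real h) - (of_real (\<alpha> / \<epsilon>) * of_real h + of_real (\<beta> / (3 * \<epsilon>)) * of_real h ^ 3))"
      by (simp flip: of_real_power of_real_mult of_real_add)
    also have "\<dots> \<le> norm (P (of_real h) - (of_real (\<alpha> / \<epsilon>) * of_real h + of_real (\<beta> / (3 * \<epsilon>)) * of_real h ^ 3))"
      by (rule complex_Re_le_cmod)
    also have "\<dots> \<le> (2 * norm (complex_of_real h) + norm (complex_of_real h) ^ 5 / \<epsilon>) * S"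
      unfolding P_def \<alpha>_def \<beta>_def S_def cubic_sum_def
      using h by (intro gf_phase_expansion \<epsilon> \<xi> \<delta>) auto
    also have "\<dots> \<le> (2 * \<delta> + \<delta>\<^sup>2 / \<beta>) * S"
    proof (intro mult_right_mono S0 add_mono)
      have "norm (complex_of_real h) ^ 5 / \<epsilon> = h\<^sup>2 / \<beta>"
        using h \<beta> by (simp add: \<epsilon>_def field_simps eval_nat_numeral)
      also have "\<dots> \<le> \<delta>\<^sup>2 / \<beta>" using h \<beta> by (intro divide_right_mono power_mono) auto
      finally show "norm (complex_of_real h) ^ 5 / \<epsilon> \<le> \<delta>\<^sup>2 / \<beta>" .
    qed (use h in auto)
    finally have "Re (P (of_real h)) \<le> \<alpha> / \<epsilon> * h + \<beta> / (3 * \<epsilon>) * h ^ 3 + (2 * \<delta> + \<delta>\<^sup>2 / \<beta>) * S" by simp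
    moreover have "\<beta> / (3 * \<epsilon>) * h ^ 3 = 1 / 3" using h \<beta> by (simp add: \<epsilon>_def)
    ultimately show ?thesis by linarith
  qed
  finally have "Re (P (Complex h (h * t))) - n * h
      \<le> (1 / 3 + (2 * \<delta> + \<delta>\<^sup>2 / \<beta>) * S) + - ((1 - \<xi>)\<^sup>2 / 9) * t\<^sup>2 + - (h * (n - \<alpha> / \<epsilon>))"
    by (simp add: algebra_simps)
  then have num: "exp (Re (P (Complex h (h * t))) - n * h)
      \<le> exp (1 / 3 + (2 * \<delta> + \<delta>\<^sup>2 / \<beta>) * S) * exp (- ((1 - \<xi>)\<^sup>2 / 9) * t\<^sup>2) * exp (- (h * (n - \<alpha> / \<epsilon>)))"
    by (simp only: exp_le_cancel_iff flip: exp_add)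
  have den: "1 - \<xi> \<le> norm (1 - of_real \<xi> * exp (- Complex h (h * t)))"
  proof -
    have "norm (of_real \<xi> * exp (- Complex h (h * t))) \<le> \<xi> * 1"
      using \<xi> h by (simp add: norm_mult)
    then show ?thesis
      using norm_triangle_ineq2[of 1 "of_real \<xi> * exp (- Complex h (h * t))"] by simp
  qed
  have "norm (contour_integrand \<xi> \<epsilon> h n t)
      = exp (Re (P (Complex h (h * t))) - n * h) / norm (1 - of_real \<xi> * exp (- Complex h (h * t)))"
    unfolding contour_integrand_def u P_def by (simp add: norm_divide)
  also have "\<dots> \<le> exp (1 / 3 + (2 * \<delta> + \<delta>\<^sup>2 / \<beta>) * S) * exp (- ((1 - \<xi>)\<^sup>2 / 9) * t\<^sup>2) * exp (- (h * (n - \<alpha> / \<epsilon>))) / (1 - \<xi>)"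
    using \<xi>1 by (intro frac_le num den) auto
  finally show ?thesis
    unfolding \<epsilon>_def contour_bound_def \<beta>_def S_def by simp
qed

text \<open>One \<open>B\<close> serves all orders and all \<open>h \<le> \<delta>\<close>; this
  uniformity later dominates the whole series of the kernel. The factor \<open>h\<close> is the
  Jacobian of the substitution.\<close>

lemma hahn_exton_int_bound:
  fixes \<xi> :: real
  defines "\<alpha> \<equiv> - 2 * ln (1 - \<xi>)" and "\<beta> \<equiv> \<xi> / (1 - \<xi>)\<^sup>2"
  assumes \<xi>: "0 < \<xi>" and \<delta>: "\<xi> * exp \<delta> < 1" "0 < \<delta>"
  obtains B where "\<And>h n. 0 < h \<Longrightarrow> h \<le> \<delta> \<Longrightarrow>
    \<bar>hahn_exton_int n (2 * \<xi>) (exp (- (\<beta> * h ^ 3)))\<bar> \<le> h * B * exp (- (h * (n - \<alpha> / (\<beta> * h ^ 3))))"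
proof
  define g where "g t = exp (- ((1 - \<xi>)\<^sup>2 / 9) * t\<^sup>2)" for t :: real
  fix h :: real and n :: int assume h: "0 < h" "h \<le> \<delta>"
  have "\<xi> \<le> \<xi> * exp \<delta>" using mult_left_mono[of 1 "exp \<delta>" \<xi>] h \<xi> by simp
  then have \<xi>1: "\<xi> < 1" using \<delta> \<xi> by linarith
  have g: "integrable lborel g"
    unfolding g_def using \<xi>1 by (intro integrable_exp_neg_square) auto
  define \<epsilon> where "\<epsilon> = \<beta> * h ^ 3"
  have \<epsilon>: "\<epsilon> > 0" using \<xi> \<xi>1 h by (simp add: \<epsilon>_def \<beta>_def)
  have "\<xi> * exp h \<le> \<xi> * exp \<delta>" using \<xi> h by (intro mult_left_mono) auto
  then have \<xi>h: "\<xi> * exp h < 1" using \<delta> by linarith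
  let ?E = "exp (- (h * (n - \<alpha> / \<epsilon>)))"
  let ?J = "hahn_exton_int n (2 * \<xi>) (exp (- \<epsilon>))"
  note C = hahn_exton_int_contour[OF \<epsilon> \<xi> h(1) \<xi>h, of n]
  have "2 * pi / h * \<bar>?J\<bar> = norm (complex_of_real (2 * pi / h * ?J))"
    using h by (simp add: abs_mult norm_mult norm_divide)
  also have "\<dots> \<le> (LINT t|lborel. norm (indicator {-pi/h..pi/h} t *\<^sub>R contour_integrand \<xi> \<epsilon> h n t))"
    unfolding C(2)[symmetric] by (rule integral_norm_bound)
  also have "\<dots> \<le> (LINT t|lborel. contour_bound \<xi> \<delta> * ?E * g t)"
  proof (rule integral_mono)
    fix t :: real
    have K: "contour_bound \<xi> \<delta> * ?E * g t \<ge> 0"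
      using \<xi>1 by (simp add: contour_bound_def g_def)
    show "norm (indicator {-pi/h..pi/h} t *\<^sub>R contour_integrand \<xi> \<epsilon> h n t) \<le> contour_bound \<xi> \<delta> * ?E * g t"
    proof (cases "t \<in> {-pi/h..pi/h}")
      case True
      then have "\<bar>h * t\<bar> \<le> pi" using h by (auto simp: abs_le_iff field_simps)
      from norm_contour_integrand_le[OF \<xi> \<delta>(1) h this, of n, folded \<alpha>_def \<beta>_def, folded \<epsilon>_def]
      show ?thesis using True by (simp add: g_def mult_ac)
    qed (use K in simp)
    show "integrable lborel (\<lambda>t. norm (indicator {-pi/h..pi/h} t *\<^sub>R contour_integrand \<xi> \<epsilon> h n t))"
      by (rule integrable_norm[OF C(1)])
    show "integrable lborel (\<lambda>t. contour_bound \<xi> \<delta> * ?E * g t)"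
      by (rule integrable_mult_right[OF g])
  qed
  also have "\<dots> = contour_bound \<xi> \<delta> * ?E * integral\<^sup>L lborel g" by simp
  finally have "\<bar>?J\<bar> \<le> h * (contour_bound \<xi> \<delta> * integral\<^sup>L lborel g / (2 * pi)) * ?E"
    using h pi_gt_zero by (simp add: field_simps)
  then show "\<bar>hahn_exton_int n (2 * \<xi>) (exp (- (\<beta> * h ^ 3)))\<bar>
      \<le> h * (contour_bound \<xi> \<delta> * integral\<^sup>L lborel (\<lambda>t. exp (- ((1 - \<xi>)\<^sup>2 / 9) * t\<^sup>2)) / (2 * pi))
        * exp (- (h * (n - \<alpha> / (\<beta> * h ^ 3))))"
    by (simp add: \<epsilon>_def g_def[abs_def])
qed

text \<open>The order is a sequence of integers whose scaled position merely approaches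
  \<open>y\<close>, because integrality prevents it from being hit exactly.\<close>

lemma hahn_exton_int_tendsto_airy:
  fixes \<xi> :: real and h :: "nat \<Rightarrow> real" and n :: "nat \<Rightarrow> int"
  defines "\<alpha> \<equiv> - 2 * ln (1 - \<xi>)" and "\<beta> \<equiv> \<xi> / (1 - \<xi>)\<^sup>2"
  assumes \<xi>: "0 < \<xi>" and \<delta>: "\<xi> * exp \<delta> < 1" and h: "\<And>i. 0 < h i" "\<And>i. h i \<le> \<delta>" "h \<longlonglongrightarrow> 0"
    and n: "(\<lambda>i. h i * (n i - \<alpha> / (\<beta> * h i ^ 3))) \<longlonglongrightarrow> y"
  shows "(\<lambda>i. hahn_exton_int (n i) (2 * \<xi>) (exp (- (\<beta> * h i ^ 3))) / h i) \<longlonglongrightarrow> airy y / (1 - \<xi>)"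
proof -
  define \<epsilon> where "\<epsilon> i = \<beta> * h i ^ 3" for i
  define N where "N i = h i * (n i - \<alpha> / \<epsilon> i)" for i
  have N: "N \<longlonglongrightarrow> y" using n by (simp add: N_def[abs_def] \<epsilon>_def)
  have "0 < \<delta>" using h(1)[of 0] h(2)[of 0] by linarith
  then have "\<xi> \<le> \<xi> * exp \<delta>" using mult_left_mono[of 1 "exp \<delta>" \<xi>] \<xi> by simp
  then have \<xi>1: "\<xi> < 1" using \<delta> \<xi> by linarith
  then have \<beta>: "\<beta> > 0" using \<xi> by (simp add: \<beta>_def)
  have \<epsilon>: "\<epsilon> i > 0" for i using \<beta> h by (simp add: \<epsilon>_def)
  have "\<xi> * exp (h i) \<le> \<xi> * exp \<delta>" for i using \<xi> h by (intro mult_left_mono) auto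
  then have \<xi>h: "\<xi> * exp (h i) < 1" for i using \<delta> by (meson le_less_trans)
  note C = hahn_exton_int_contour[OF \<epsilon> \<xi> h(1) \<xi>h]
  define s where "s i t = indicator {-pi / h i..pi / h i} t *\<^sub>R contour_integrand \<xi> (\<epsilon> i) (h i) (n i) t" for i t
  obtain M where M: "\<And>i. norm (N i) \<le> M" using convergent_imp_Bseq[of N] N by (auto simp: convergent_def Bseq_def)
  define S where "S = cubic_sum (\<xi> * exp \<delta>)"
  have lim: "(\<lambda>i. s i t) \<longlonglongrightarrow> airy_integrand y t / of_real (1 - \<xi>)" for t
  proof -
    define w where "w = Complex 1 t"
    have hw: "(\<lambda>i. of_real (h i) * w) \<longlonglongrightarrow> of_real 0 * w"
      by (intro tendsto_intros h(3))
    \<comment> \<open>Expansion error at \<open>h * w\<close> for fixed \<open>w\<close>, a point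
      that eventually lies in the disc of validity. The order cancels the linear term up to
      \<open>N i * w\<close>, and the cubic term is exactly \<open>w ^ 3 / 3\<close>.\<close>
    define D where "D i = gf_phase \<xi> (exp (- \<epsilon> i)) (of_real (h i) * w)
      - (of_real (\<alpha> / \<epsilon> i) * (of_real (h i) * w) + of_real (\<beta> / (3 * \<epsilon> i)) * (of_real (h i) * w) ^ 3)" for i
    have "(\<lambda>i. h i * norm w) \<longlonglongrightarrow> 0 * norm w" by (intro tendsto_intros h(3))
    then have ev: "eventually (\<lambda>i. h i * norm w < \<delta>) sequentially"
      using \<open>0 < \<delta>\<close> by (intro order_tendstoD) auto
    have "D \<longlonglongrightarrow> 0"
    proof (rule Lim_null_comparison)
      show "eventually (\<lambda>i. norm (D i) \<le> (2 * (h i * norm w) + (h i)\<^sup>2 / \<beta> * norm w ^ 5) * S) sequentially"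
        using ev
      proof eventually_elim
        case (elim i)
        have nw: "norm (of_real (h i) * w) = h i * norm w" using h(1)[of i] by (simp add: norm_mult)
        have "norm (D i) \<le> (2 * norm (of_real (h i) * w) + norm (of_real (h i) * w) ^ 5 / \<epsilon> i) * S"
          unfolding D_def S_def cubic_sum_def \<alpha>_def \<beta>_def
          using elim nw by (intro gf_phase_expansion \<epsilon> \<xi> \<delta>) auto
        also have "norm (of_real (h i) * w) ^ 5 / \<epsilon> i = (h i)\<^sup>2 / \<beta> * norm w ^ 5"
          unfolding nw \<epsilon>_def using \<beta> h(1)[of i] by (simp add: field_simps eval_nat_numeral)
        finally show ?case unfolding nw .
      qed
      have "(\<lambda>i. (2 * (h i * norm w) + (h i)\<^sup>2 / \<beta> * norm w ^ 5) * S) \<longlonglongrightarrow> (2 * (0 * norm w) + 0\<^sup>2 / \<beta> * norm w ^ 5) * S"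
        using \<beta> by (intro tendsto_intros h(3)) auto
      then show "(\<lambda>i. (2 * (h i * norm w) + (h i)\<^sup>2 / \<beta> * norm w ^ 5) * S) \<longlonglongrightarrow> 0" by simp
    qed
    then have "(\<lambda>i. exp (D i + w ^ 3 / 3 - of_real (N i) * w) / (1 - of_real \<xi> * exp (- (of_real (h i) * w))))
        \<longlonglongrightarrow> exp (0 + w ^ 3 / 3 - of_real y * w) / (1 - of_real \<xi> * exp (- (of_real 0 * w)))"
      using \<xi>1 by (intro tendsto_intros N hw) auto
    also have "exp (0 + w ^ 3 / 3 - of_real y * w) / (1 - of_real \<xi> * exp (- (of_real 0 * w)))
        = airy_integrand y t / of_real (1 - \<xi>)"
      by (simp add: airy_integrand_def w_def)
    also have "(\<lambda>i. exp (D i + w ^ 3 / 3 - of_real (N i) * w) / (1 - of_real \<xi> * exp (- (of_real (h i) * w))))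
        = (\<lambda>i. contour_integrand \<xi> (\<epsilon> i) (h i) (n i) t)"
    proof
      fix i
      have "of_real (\<beta> / (3 * \<epsilon> i)) * (of_real (h i) * w) ^ 3 = w ^ 3 / 3"
        using \<beta> h(1)[of i] by (simp add: \<epsilon>_def power_mult_distrib)
      then have "D i + w ^ 3 / 3 - of_real (N i) * w
          = gf_phase \<xi> (exp (- \<epsilon> i)) (of_real (h i) * w) - of_int (n i) * (of_real (h i) * w)"
        unfolding D_def N_def by (simp add: algebra_simps)
      then show "exp (D i + w ^ 3 / 3 - of_real (N i) * w) / (1 - of_real \<xi> * exp (- (of_real (h i) * w)))
          = contour_integrand \<xi> (\<epsilon> i) (h i) (n i) t"
        unfolding contour_integrand_def w_def by simp
    qed
    finally have "(\<lambda>i. contour_integrand \<xi> (\<epsilon> i) (h i) (n i) t) \<longlonglongrightarrow> airy_integrand y t / of_real (1 - \<xi>)" .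
    moreover have "eventually (\<lambda>i. contour_integrand \<xi> (\<epsilon> i) (h i) (n i) t = s i t) sequentially"
    proof -
      have "(\<lambda>i. h i * \<bar>t\<bar>) \<longlonglongrightarrow> 0 * \<bar>t\<bar>" by (intro tendsto_intros h(3))
      then have "eventually (\<lambda>i. h i * \<bar>t\<bar> < pi) sequentially" by (intro order_tendstoD) auto
      then show ?thesis
      proof eventually_elim
        case (elim i)
        then have "\<bar>t\<bar> \<le> pi / h i" using h(1)[of i] by (simp add: field_simps)
        then have "t \<in> {-pi / h i..pi / h i}" by auto
        then show ?case by (simp add: s_def)
      qed
    qed
    ultimately show ?thesis by (rule Lim_transform_eventually)
  qed
  have "(\<lambda>i. integral\<^sup>L lborel (s i)) \<longlonglongrightarrow> (LINT t|lborel. airy_integrand y t / of_real (1 - \<xi>))"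
  proof (rule integral_dominated_convergence)
    show "integrable lborel (\<lambda>t. contour_bound \<xi> \<delta> * exp M * exp (- ((1 - \<xi>)\<^sup>2 / 9) * t\<^sup>2))"
      using \<xi>1 by (intro integrable_mult_right integrable_exp_neg_square) auto
    show "s i \<in> borel_measurable lborel" for i
      using C(1) unfolding s_def by (rule borel_measurable_integrable)
    show "(\<lambda>t. airy_integrand y t / of_real (1 - \<xi>)) \<in> borel_measurable lborel"
      using integrable_airy_integrand[of y] by auto
    show "AE t in lborel. norm (s i t) \<le> contour_bound \<xi> \<delta> * exp M * exp (- ((1 - \<xi>)\<^sup>2 / 9) * t\<^sup>2)" for i
    proof (intro AE_I2)
      fix t
      have K: "contour_bound \<xi> \<delta> \<ge> 0" using \<xi>1 by (simp add: contour_bound_def)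
      show "norm (s i t) \<le> contour_bound \<xi> \<delta> * exp M * exp (- ((1 - \<xi>)\<^sup>2 / 9) * t\<^sup>2)"
      proof (cases "t \<in> {-pi / h i..pi / h i}")
        case True
        then have "\<bar>h i * t\<bar> \<le> pi" using h(1)[of i] by (auto simp: abs_le_iff field_simps)
        from norm_contour_integrand_le[OF \<xi> \<delta> h(1,2) this, of "n i", folded \<alpha>_def \<beta>_def, folded \<epsilon>_def, folded N_def]
        have "norm (s i t) \<le> contour_bound \<xi> \<delta> * exp (- ((1 - \<xi>)\<^sup>2 / 9) * t\<^sup>2) * exp (- N i)"
          using True by (simp add: s_def)
        also have "\<dots> \<le> contour_bound \<xi> \<delta> * exp (- ((1 - \<xi>)\<^sup>2 / 9) * t\<^sup>2) * exp M"
          using M[of i] K by (intro mult_left_mono) auto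
        finally show ?thesis by (simp add: mult_ac)
      qed (use K in \<open>simp add: s_def\<close>)
    qed
  qed (use lim in auto)
  then have "(\<lambda>i. Re (integral\<^sup>L lborel (s i)) / (2 * pi)) \<longlonglongrightarrow> Re (LINT t|lborel. airy_integrand y t / of_real (1 - \<xi>)) / (2 * pi)"
    by (intro tendsto_intros) auto
  also have "(\<lambda>i. Re (integral\<^sup>L lborel (s i)) / (2 * pi)) = (\<lambda>i. hahn_exton_int (n i) (2 * \<xi>) (exp (- (\<beta> * h i ^ 3))) / h i)"
    unfolding s_def C(2) by (simp add: \<epsilon>_def)
  also have "Re (LINT t|lborel. airy_integrand y t / of_real (1 - \<xi>)) / (2 * pi) = airy y / (1 - \<xi>)"
    by (simp add: airy_eq_integral Re_divide_of_real del: of_real_diff)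
  finally show ?thesis .
qed

section \<open>The q-Bessel kernel as a series\<close>

text \<open>Passing from \<open>z\<close> to \<open>q * z\<close> adds one factor to the product in
  \<open>1 / z\<close> and removes one from the product in \<open>z\<close>. Compared
  coefficientwise this is the three-term recurrence below.\<close>

lemma hahn_exton_gf_shift:
  assumes q: "0 < q" "q < 1" and z: "z \<noteq> 0" "of_real \<xi> * z \<noteq> 1"
  shows "hahn_exton_gf \<xi> q (of_real q * z) = (1 - of_real \<xi> / z) * (1 - of_real \<xi> * z) * hahn_exton_gf \<xi> q z"
proof -
  let ?q = "complex_of_real q"
  have nq: "norm ?q < 1" using q by simp
  have st: "qpoch_inf (of_real \<xi> / z) ?q = (1 - of_real \<xi> / z) * qpoch_inf (?q * (of_real \<xi> / z)) ?q"
    "qpoch_inf (of_real \<xi> * z) ?q = (1 - of_real \<xi> * z) * qpoch_inf (?q * (of_real \<xi> * z)) ?q"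
    by (rule qpoch_inf_step[OF nq])+
  have e: "of_real (q * \<xi>) / (?q * z) = of_real \<xi> / z" "of_real \<xi> * (?q * z) = ?q * (of_real \<xi> * z)"
    "of_real (q * \<xi>) / z = ?q * (of_real \<xi> / z)"
    using q by simp_all
  have cancel: "x * a / b = x * w * (a / (w * b))" if "w \<noteq> 0" for x a b w :: complex
    using that by simp
  have "1 - of_real \<xi> * z \<noteq> 0" using z by simp
  then show ?thesis
    unfolding hahn_exton_gf_def e st by (rule cancel)
qed

lemma hahn_exton_int_recurrence:
  assumes q: "0 < q" "q < 1" and \<xi>: "\<bar>\<xi>\<bar> < 1"
  shows "\<xi> * (hahn_exton_int (m + 1) (2 * \<xi>) q + hahn_exton_int (m - 1) (2 * \<xi>) q)
    = (1 + \<xi>\<^sup>2 - q powi m) * hahn_exton_int m (2 * \<xi>) q"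
proof -
  define J where "J m = hahn_exton_int m (2 * \<xi>) q" for m
  let ?J = "\<lambda>m. complex_of_real (J m)"
  have "(\<lambda>m. ?J m * of_real q powi m)
      = (\<lambda>m. (1 + (of_real \<xi>)\<^sup>2) * ?J m - of_real \<xi> * ?J (m - 1) - of_real \<xi> * ?J (m + 1))"
  proof (rule laurent_unit_circle_unique)
    fix z :: complex assume nz: "norm z = 1"
    then have z: "z \<noteq> 0" by auto
    have \<xi>z: "norm (of_real \<xi> * z) < 1" using nz \<xi> by (simp add: norm_mult)
    then have \<xi>z1: "of_real \<xi> * z \<noteq> 1" by auto
    have "norm (of_real \<xi> * (of_real q * z)) = q * norm (of_real \<xi> * z)"
      using q by (simp add: norm_mult)
    also have "\<dots> \<le> 1 * norm (of_real \<xi> * z)" using q by (intro mult_right_mono) auto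
    finally have "norm (of_real \<xi> * (of_real q * z)) < 1" using \<xi>z by linarith
    then have "((\<lambda>m. ?J m * (of_real q * z) powi m) has_sum hahn_exton_gf \<xi> q (of_real q * z)) UNIV"
      unfolding J_def using z q by (intro hahn_exton_int_has_sum q \<xi>) auto
    then show "((\<lambda>m. ?J m * of_real q powi m * z powi m) has_sum hahn_exton_gf \<xi> q (of_real q * z)) UNIV"
      by (simp add: power_int_mult_distrib mult.assoc)
    let ?S = "hahn_exton_gf \<xi> q z"
    have S: "((\<lambda>m. ?J m * z powi m) has_sum ?S) UNIV"
      unfolding J_def by (rule hahn_exton_int_has_sum[OF q \<xi> z \<xi>z])
    have bij: "bij_betw (\<lambda>m. m + k) UNIV UNIV" for k :: int
      by (rule bij_betw_byWitness[of _ "\<lambda>m. m - k"]) auto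
    have Sk: "((\<lambda>m. ?J (m + k) * z powi (m + k)) has_sum ?S) UNIV" for k
      using S has_sum_reindex_bij_betw[OF bij[of k], of "\<lambda>m. ?J m * z powi m" ?S] by simp
    have S1: "((\<lambda>m. ?J (m - 1) * z powi m) has_sum (z * ?S)) UNIV"
      using has_sum_cmult_right[OF Sk[of "-1"], of z] z by (simp add: power_int_diff mult_ac)
    have S2: "((\<lambda>m. ?J (m + 1) * z powi m) has_sum (inverse z * ?S)) UNIV"
      using has_sum_cmult_right[OF Sk[of 1], of "inverse z"] z by (simp add: power_int_add field_simps)
    have "((\<lambda>m. (1 + (of_real \<xi>)\<^sup>2) * (?J m * z powi m) + (- of_real \<xi>) * (?J (m - 1) * z powi m)
        + (- of_real \<xi>) * (?J (m + 1) * z powi m)) has_sum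
        ((1 + (of_real \<xi>)\<^sup>2) * ?S + (- of_real \<xi>) * (z * ?S) + (- of_real \<xi>) * (inverse z * ?S))) UNIV"
      by (intro has_sum_add has_sum_cmult_right S S1 S2)
    also have "(1 + (of_real \<xi>)\<^sup>2) * ?S + (- of_real \<xi>) * (z * ?S) + (- of_real \<xi>) * (inverse z * ?S)
        = hahn_exton_gf \<xi> q (of_real q * z)"
      unfolding hahn_exton_gf_shift[OF q z \<xi>z1] using z by (simp add: field_simps power2_eq_square)
    finally show "((\<lambda>m. ((1 + (of_real \<xi>)\<^sup>2) * ?J m - of_real \<xi> * ?J (m - 1) - of_real \<xi> * ?J (m + 1)) * z powi m)
        has_sum hahn_exton_gf \<xi> q (of_real q * z)) UNIV"
      by (simp add: algebra_simps)
  qed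
  then have "?J m * of_real q powi m = (1 + (of_real \<xi>)\<^sup>2) * ?J m - of_real \<xi> * ?J (m - 1) - of_real \<xi> * ?J (m + 1)"
    by (rule fun_cong)
  then have "complex_of_real (J m * q powi m) = of_real ((1 + \<xi>\<^sup>2) * J m - \<xi> * J (m - 1) - \<xi> * J (m + 1))"
    by simp
  then have "J m * q powi m = (1 + \<xi>\<^sup>2) * J m - \<xi> * J (m - 1) - \<xi> * J (m + 1)"
    by (rule of_real_eq_iff[THEN iffD1])
  then show ?thesis by (simp add: J_def algebra_simps)
qed

text \<open>Supplies the vanishing boundary term of the telescoping sum: the Laurent series
  converges at \<open>z = 1\<close>.\<close>

lemma hahn_exton_int_tendsto_0:
  assumes q: "0 < q" "q < 1" and \<xi>: "\<bar>\<xi>\<bar> < 1"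
  shows "(\<lambda>k. hahn_exton_int (m + int k) (2 * \<xi>) q) \<longlonglongrightarrow> 0"
proof -
  have "((\<lambda>m. of_real (hahn_exton_int m (2 * \<xi>) q) * 1 powi m) has_sum hahn_exton_gf \<xi> q 1) UNIV"
    using \<xi> by (intro hahn_exton_int_has_sum q \<xi>) auto
  then have "(\<lambda>m. complex_of_real (hahn_exton_int m (2 * \<xi>) q)) summable_on UNIV"
    by (auto dest: has_sum_imp_summable)
  then have "(\<lambda>m. complex_of_real (hahn_exton_int m (2 * \<xi>) q)) summable_on range (\<lambda>k. m + int k)"
    by (rule summable_on_subset_banach) simp
  then have "((\<lambda>m. complex_of_real (hahn_exton_int m (2 * \<xi>) q)) \<circ> (\<lambda>k. m + int k)) summable_on UNIV"
    by (subst (asm) summable_on_reindex) (auto simp: inj_on_def)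
  then have "summable ((\<lambda>m. complex_of_real (hahn_exton_int m (2 * \<xi>) q)) \<circ> (\<lambda>k. m + int k))"
    by (rule summable_on_imp_summable)
  then have "(\<lambda>k. complex_of_real (hahn_exton_int (m + int k) (2 * \<xi>) q)) \<longlonglongrightarrow> of_real 0"
    using summable_LIMSEQ_zero by (fastforce simp: o_def)
  then show ?thesis by (simp only: tendsto_of_real_iff)
qed

lemma hahn_exton_of_int: "hahn_exton (of_int m) x q = hahn_exton_int m x q"
  by (simp add: hahn_exton_def)

text \<open>
  Off the diagonal the recurrence makes the series telescope, as in the Christoffel--Darboux formula.
\<close>

lemma q_bessel_kernel_series:
  fixes m n :: int
  assumes q: "0 < q" "q < 1" and \<xi>: "0 < \<xi>" "\<xi> < 1"
  shows "q_bessel_kernel \<xi> q (m - 1 / 2) (n - 1 / 2) = q powr ((real_of_int m + n - 1) / 2) *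
    (\<Sum>j. q powr (j + 1 / 2) * (hahn_exton_int (m + int j) (2 * \<xi>) q * hahn_exton_int (n + int j) (2 * \<xi>) q))"
proof (cases "m = n")
  case True
  have "real_of_int n - 1 / 2 + (real j + 1 / 2) = of_int (n + int j)" for j by simp
  then show ?thesis
    using True by (simp only: q_bessel_kernel_def Let_def if_True simp_thms hahn_exton_of_int mult.assoc) simp
next
  case False
  have \<xi>1: "\<bar>\<xi>\<bar> < 1" using \<xi> by auto
  define J where "J m = hahn_exton_int m (2 * \<xi>) q" for m
  let ?r = "real_of_int m - 1 / 2" and ?s = "real_of_int n - 1 / 2"
  have rec: "\<xi> * (J (m + 1) + J (m - 1)) = (1 + \<xi>\<^sup>2 - q powi m) * J m" for m
    unfolding J_def by (rule hahn_exton_int_recurrence[OF q \<xi>1])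
  \<comment> \<open>The numerator of the quotient with both arguments shifted by \<open>k\<close>,
    so \<open>D 0\<close> is the one in the kernel. In \<open>D k - D (Suc k)\<close> the recurrence
    eliminates the neighbouring orders, and the common part \<open>1 + \<xi>\<^sup>2\<close> drops
    out.\<close>
  define D where "D k = \<xi> * (J (m + int k) * J (n + int k - 1) - J (m + int k - 1) * J (n + int k))" for k
  define a where "a k = q powr (real k + 1 / 2) * (J (m + int k) * J (n + int k))" for k
  define c where "c = q powr ((?r - ?s) / 2) - q powr (- (?r - ?s) / 2)"
  define Q where "Q = q powr ((real_of_int m + n - 1) / 2)"
  have step: "D k - D (Suc k) = Q * c * a k" for k
  proof -
    let ?M = "m + int k" and ?N = "n + int k"
    have "D k - D (Suc k) = J ?M * (\<xi> * (J (?N + 1) + J (?N - 1))) - J ?N * (\<xi> * (J (?M + 1) + J (?M - 1)))"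
      by (simp add: D_def algebra_simps)
    also have "\<dots> = (q powi ?M - q powi ?N) * (J ?M * J ?N)"
      unfolding rec by (simp add: algebra_simps)
    \<comment> \<open>Pulling out the mean exponent \<open>(m + n) / 2 + k\<close> leaves the
      denominator \<open>c\<close> of the quotient.\<close>
    also have "q powi ?M - q powi ?N = Q * c * q powr (real k + 1 / 2)"
    proof -
      have P: "q powi l = q powr (of_int l)" for l
        using q by (simp add: powr_real_of_int')
      have Q: "Q * q powr ((?r - ?s) / 2) * q powr (real k + 1 / 2) = q powr (of_int ?M)"
        "Q * q powr (- (?r - ?s) / 2) * q powr (real k + 1 / 2) = q powr (of_int ?N)"
        unfolding Q_def powr_add[symmetric] by (rule arg_cong[of _ _ "(powr) q"], simp add: field_simps)+
      show ?thesis
        unfolding P Q[symmetric] c_def by (simp only: algebra_simps)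
    qed
    finally show ?thesis by (simp add: a_def mult_ac)
  qed
  have J0: "(\<lambda>k. J (m + int k)) \<longlonglongrightarrow> 0" for m
    unfolding J_def by (rule hahn_exton_int_tendsto_0[OF q \<xi>1])
  have "D \<longlonglongrightarrow> \<xi> * (0 * 0 - 0 * 0)"
    unfolding D_def
    using J0[of m] J0[of n] J0[of "m - 1"] J0[of "n - 1"]
    by (intro tendsto_intros) (simp_all add: algebra_simps)
  then have "(\<lambda>k. D k - D (Suc k)) sums (D 0 - 0)" by (intro telescope_sums') simp
  then have "(\<lambda>k. Q * c * a k) sums D 0" by (simp add: step)
  moreover have Q: "Q \<noteq> 0" using q by (simp add: Q_def)
  moreover have c: "c \<noteq> 0"
    using False q powr_inj[of q "(?r - ?s) / 2" "- (?r - ?s) / 2"] by (simp add: c_def)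
  ultimately have "(\<lambda>k. a k) sums (D 0 / (Q * c))"
    using sums_mult_D[of "Q * c" a "D 0"] by simp
  then have "Q * suminf a = D 0 / c" using Q by (simp add: sums_iff field_simps)
  moreover have "q_bessel_kernel \<xi> q ?r ?s = D 0 / c"
  proof -
    have e: "?r + 1 / 2 = of_int m" "?r - 1 / 2 = of_int (m - 1)" "?s + 1 / 2 = of_int n" "?s - 1 / 2 = of_int (n - 1)"
      by simp_all
    have "?r \<noteq> ?s" using False by simp
    then show ?thesis
      unfolding q_bessel_kernel_def Let_def e hahn_exton_of_int c_def D_def J_def by simp
  qed
  ultimately show ?thesis by (simp add: a_def[abs_def] J_def Q_def)
qed

text \<open>Puts sums of varying mesh \<open>h\<close> on one fixed measure space, where dominated
  convergence applies as the mesh tends to 0.\<close>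

lemma integral_step_function:
  fixes g :: "nat \<Rightarrow> real"
  assumes h: "h > 0" and g: "summable (\<lambda>j. \<bar>g j\<bar>)"
  shows "(LINT z|lborel. indicator {0..} z * g (nat \<lfloor>z / h\<rfloor>)) = h * suminf g"
proof -
  define f where "f j z = indicator {h * real j..<h * (real j + 1)} z * g j" for j :: nat and z :: real
  have fi: "has_bochner_integral lborel (\<lambda>z. indicator {h * real j..<h * (real j + 1)} z * c) (h * c)" for j and c :: real
  proof -
    have "measure lborel {h * real j..<h * (real j + 1)} = h" using h by (simp add: algebra_simps)
    then show ?thesis
      using has_bochner_integral_mult_left[OF has_bochner_integral_real_indicator[of "{h * real j..<h * (real j + 1)}" lborel], of c]
        h by simp
  qed
  have sum: "(\<lambda>j. f j z) sums (indicator {0..} z * g (nat \<lfloor>z / h\<rfloor>))"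
    and fin: "finite {j. f j z \<noteq> 0}" for z
  proof -
    have *: "f j z = (if j = nat \<lfloor>z / h\<rfloor> then indicator {0..} z * g j else 0)" for j
    proof (cases "z \<ge> 0")
      case True
      then have "\<lfloor>z / h\<rfloor> \<ge> 0" using h by simp
      then have "j = nat \<lfloor>z / h\<rfloor> \<longleftrightarrow> \<lfloor>z / h\<rfloor> = int j" by auto
      also have "\<dots> \<longleftrightarrow> real j \<le> z / h \<and> z / h < real j + 1" by (simp add: floor_eq_iff)
      also have "\<dots> \<longleftrightarrow> z \<in> {h * real j..<h * (real j + 1)}" using h by (simp add: le_divide_eq divide_less_eq mult.commute add.commute)
      finally show ?thesis using True by (auto simp: f_def)
    next
      case False
      have "0 \<le> h * j" using h by simp
      then show ?thesis using False by (auto simp: f_def)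
    qed
    show "(\<lambda>j. f j z) sums (indicator {0..} z * g (nat \<lfloor>z / h\<rfloor>))"
      unfolding * by (rule sums_single)
    show "finite {j. f j z \<noteq> 0}"
      by (rule finite_subset[of _ "{nat \<lfloor>z / h\<rfloor>}"]) (auto simp: *)
  qed
  have "(LINT z|lborel. (\<Sum>j. f j z)) = (\<Sum>j. integral\<^sup>L lborel (f j))"
  proof (rule integral_suminf)
    show "integrable lborel (f j)" for j
      using fi[of j "g j"] unfolding f_def[abs_def] has_bochner_integral_iff by (rule conjunct1)
    show "AE z in lborel. summable (\<lambda>j. norm (f j z))"
      by (intro AE_I2 summable_finite[OF fin]) simp
    have "(LINT z|lborel. norm (f j z)) = h * \<bar>g j\<bar>" for j
      using fi[of j "\<bar>g j\<bar>"] unfolding f_def has_bochner_integral_iff by (simp add: abs_mult)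
    then show "summable (\<lambda>j. LINT z|lborel. norm (f j z))" using g by (simp add: summable_mult)
  qed
  moreover have "integral\<^sup>L lborel (f j) = h * g j" for j
    using fi[of j "g j"] unfolding f_def[abs_def] has_bochner_integral_iff by (rule conjunct2)
  moreover have "(\<Sum>j. f j z) = indicator {0..} z * g (nat \<lfloor>z / h\<rfloor>)" for z
    using sum by (simp add: sums_iff)
  ultimately show ?thesis using suminf_mult[OF summable_rabs_cancel[OF g], of h] by simp
qed

lemma integrable_exp_neg_Ici:
  fixes a :: real
  assumes "a > 0"
  shows "integrable lborel (\<lambda>z. indicator {0..} z * exp (- a * z))"
proof -
  have "set_integrable lebesgue {0..} (\<lambda>z. exp (- a * z))"
    by (intro nonnegative_absolutely_integrable_1 integrable_on_exp_minus_to_infinity assms) auto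
  then show ?thesis
    by (subst (asm) set_integrable_def, subst (asm) integrable_completion) auto
qed

section \<open>The edge scaling limit\<close>

text \<open>Rounding costs less than 1 and the offset between half-integer arguments and integer
  orders costs 1/2; the generous bound 2 becomes an error of order \<open>h\<close> after
  scaling.\<close>

lemma scaled_index:
  fixes a h x m :: real
  assumes "0 < h" "\<bar>m - 1 / 2 - (a + x / h)\<bar> < 1"
  shows "\<bar>h * (m - a) - x\<bar> \<le> 2 * h"
proof -
  have "h * (m - a) - x = h * (m - a - x / h)" using assms by (simp add: field_simps)
  moreover have "\<bar>m - a - x / h\<bar> \<le> 2" using assms(2) by (simp add: abs_if split: if_splits)
  ultimately show ?thesis using assms(1) by (simp add: abs_mult mult.commute)
qed

text \<open>Each \<open>J\<close> contributes a factor \<open>h\<close>, so the prefactor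
  \<open>1 / h\<close> leaves one \<open>h\<close>, the mesh of the Riemann sum. The constants
  balance as well: two factors \<open>1 / (1 - \<xi>)\<close> from the Airy limits meet
  \<open>Q\<close>, which tends to \<open>exp (- \<alpha>) = (1 - \<xi>)\<^sup>2\<close>.\<close>

lemma q_bessel_kernel_tendsto_airy_kernel:
  fixes \<xi> x y :: real and h :: "nat \<Rightarrow> real" and m n :: "nat \<Rightarrow> int"
  defines "\<alpha> \<equiv> - 2 * ln (1 - \<xi>)" and "\<beta> \<equiv> \<xi> / (1 - \<xi>)\<^sup>2"
  assumes \<xi>: "0 < \<xi>" and \<delta>: "\<xi> * exp \<delta> < 1"
    and h: "\<And>i. 0 < h i" "\<And>i. h i \<le> \<delta>" "h \<longlonglongrightarrow> 0"
    and m: "\<And>i. \<bar>m i - 1 / 2 - (\<alpha> / (\<beta> * h i ^ 3) + x / h i)\<bar> < 1"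
    and n: "\<And>i. \<bar>n i - 1 / 2 - (\<alpha> / (\<beta> * h i ^ 3) + y / h i)\<bar> < 1"
  shows "(\<lambda>i. 1 / h i * q_bessel_kernel \<xi> (exp (- (\<beta> * h i ^ 3))) (m i - 1 / 2) (n i - 1 / 2))
    \<longlonglongrightarrow> airy_kernel x y"
proof -
  have \<delta>0: "0 < \<delta>" using h(1)[of 0] h(2)[of 0] by linarith
  then have "\<xi> \<le> \<xi> * exp \<delta>" using mult_left_mono[of 1 "exp \<delta>" \<xi>] \<xi> by simp
  then have \<xi>1: "\<xi> < 1" using \<delta> \<xi> by linarith
  then have \<beta>: "\<beta> > 0" using \<xi> by (simp add: \<beta>_def)
  define \<epsilon> where "\<epsilon> i = \<beta> * h i ^ 3" for i
  have \<epsilon>: "\<epsilon> i > 0" for i using \<beta> h by (simp add: \<epsilon>_def)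
  define q where "q i = exp (- \<epsilon> i)" for i
  have q: "0 < q i" "q i < 1" for i using \<epsilon>[of i] by (auto simp: q_def)
  define J where "J i k = hahn_exton_int k (2 * \<xi>) (q i)" for i k
  define M where "M i = h i * (m i - \<alpha> / \<epsilon> i)" for i
  define N where "N i = h i * (n i - \<alpha> / \<epsilon> i)" for i
  have Mx: "\<bar>M i - x\<bar> \<le> 2 * h i" and Ny: "\<bar>N i - y\<bar> \<le> 2 * h i" for i
    unfolding M_def N_def \<epsilon>_def using m n by (auto intro!: scaled_index h)
  have h2: "(\<lambda>i. 2 * h i) \<longlonglongrightarrow> 0" using tendsto_mult_right_zero[OF h(3)] by simp
  have M: "M \<longlonglongrightarrow> x"
    by (rule LIM_zero_cancel, rule Lim_null_comparison[OF _ h2]) (simp add: Mx)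
  have N: "N \<longlonglongrightarrow> y"
    by (rule LIM_zero_cancel, rule Lim_null_comparison[OF _ h2]) (simp add: Ny)
  obtain B where B: "\<And>i k. \<bar>J i k\<bar> \<le> h i * B * exp (- (h i * (k - \<alpha> / \<epsilon> i)))"
    using hahn_exton_int_bound[OF \<xi> \<delta> \<delta>0] h(1,2) unfolding J_def q_def \<epsilon>_def \<alpha>_def \<beta>_def by metis
  have B0: "B \<ge> 0"
  proof -
    have "0 \<le> h 0 * B * exp (- (h 0 * (0 - \<alpha> / \<epsilon> 0)))" using B[of 0 0] by simp
    then show ?thesis using h(1)[of 0] by (simp add: zero_le_mult_iff)
  qed
  \<comment> \<open>The scaled order is at least
    \<open>z - 2 * h + h * j = z - 3 * h + h * (j + 1)\<close>, and \<open>h \<le> \<delta>\<close>.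
    The form with \<open>j + 1\<close> is chosen because \<open>h * (j + 1)\<close> is the right end
    of the j-th mesh cell and so bounds every point of it.\<close>
  have Jb: "\<bar>J i (k + int j)\<bar> / h i \<le> B * exp (- (z - 3 * \<delta>)) * exp (- (h i * (real j + 1)))"
    if "\<bar>h i * (k - \<alpha> / \<epsilon> i) - z\<bar> \<le> 2 * h i" for i k j z
  proof -
    have "\<bar>J i (k + int j)\<bar> / h i \<le> B * exp (- (h i * ((k + int j) - \<alpha> / \<epsilon> i)))"
      using B[of i "k + int j"] h(1)[of i] by (simp add: field_simps)
    also have "\<dots> \<le> B * exp (- (z - 3 * \<delta>) + - (h i * (real j + 1)))"
      using that h(2)[of i] B0 by (intro mult_left_mono) (simp_all add: algebra_simps abs_le_iff)
    finally show ?thesis by (simp only: exp_add mult.assoc)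
  qed
  define Q where "Q i = q i powr ((real_of_int (m i) + n i - 1) / 2)" for i
  have "Q \<longlonglongrightarrow> (1 - \<xi>)\<^sup>2"
  proof -
    have "Q = (\<lambda>i. exp (- (\<alpha> + (\<beta> * (h i)\<^sup>2 * (M i + N i) - \<beta> * h i ^ 3) / 2)))"
    proof
      fix i
      have "Q i = exp (- (\<epsilon> i * (real_of_int (m i) + n i - 1) / 2))"
        using q[of i] by (simp add: Q_def powr_def q_def)
      also have "\<epsilon> i * (real_of_int (m i) + n i - 1) / 2 = \<alpha> + (\<beta> * (h i)\<^sup>2 * (M i + N i) - \<beta> * h i ^ 3) / 2"
        using h(1)[of i] \<beta> unfolding M_def N_def \<epsilon>_def
        by (simp add: field_simps power2_eq_square power3_eq_cube)
      finally show "Q i = exp (- (\<alpha> + (\<beta> * (h i)\<^sup>2 * (M i + N i) - \<beta> * h i ^ 3) / 2))" .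
    qed
    moreover have "(\<lambda>i. exp (- (\<alpha> + (\<beta> * (h i)\<^sup>2 * (M i + N i) - \<beta> * h i ^ 3) / 2)))
        \<longlonglongrightarrow> exp (- (\<alpha> + (\<beta> * 0\<^sup>2 * (x + y) - \<beta> * 0 ^ 3) / 2))"
      by (intro tendsto_intros h(3) M N) auto
    moreover have "exp (- \<alpha>) = (1 - \<xi>)\<^sup>2"
      using \<xi>1 by (simp add: \<alpha>_def exp_double)
    ultimately show ?thesis by simp
  qed
  note Q = this
  obtain A where A: "\<And>i. \<bar>Q i\<bar> \<le> A" using convergent_imp_Bseq[of Q] Q by (auto simp: convergent_def Bseq_def)
  define g where "g i j = Q i * (q i powr (j + 1 / 2) * ((J i (m i + int j) / h i) * (J i (n i + int j) / h i)))" for i and j :: nat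
  define W where "W = A * (B * exp (- (x - 3 * \<delta>)) * (B * exp (- (y - 3 * \<delta>))))"
  have A0: "A \<ge> 0" using A[of 0] by linarith
  have W0: "W \<ge> 0" unfolding W_def using A0 B0 by simp
  have gb: "\<bar>g i j\<bar> \<le> W * exp (- (2 * (h i * (real j + 1))))" for i j
  proof -
    let ?e = "exp (- (h i * (real j + 1)))"
    have 1: "\<bar>J i (m i + int j) / h i\<bar> \<le> B * exp (- (x - 3 * \<delta>)) * ?e"
      and 2: "\<bar>J i (n i + int j) / h i\<bar> \<le> B * exp (- (y - 3 * \<delta>)) * ?e"
      using Jb[OF Mx[unfolded M_def]] Jb[OF Ny[unfolded N_def]] h(1)[of i] by simp_all
    have 3: "\<bar>q i powr (real j + 1 / 2)\<bar> \<le> 1" using q[of i] by (simp add: powr_le1)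
    have "\<bar>g i j\<bar> \<le> A * (1 * ((B * exp (- (x - 3 * \<delta>)) * ?e) * (B * exp (- (y - 3 * \<delta>)) * ?e)))"
      unfolding g_def abs_mult
      by (rule mult_mono[OF A mult_mono[OF 3 mult_mono[OF 1 2]]]) (use A0 B0 in simp_all)
    also have "\<dots> = W * (?e * ?e)" by (simp add: W_def)
    also have "?e * ?e = exp (- (2 * (h i * (real j + 1))))" by (simp flip: exp_add)
    finally show ?thesis .
  qed
  have gs: "summable (\<lambda>j. \<bar>g i j\<bar>)" for i
  proof (rule summable_comparison_test')
    show "summable (\<lambda>j. W * exp (- (2 * h i)) ^ Suc j)"
      using h(1)[of i] by (intro summable_mult summable_Suc_iff[THEN iffD2] summable_geometric) auto
    show "norm \<bar>g i j\<bar> \<le> W * exp (- (2 * h i)) ^ Suc j" for j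
      using gb[of i j] by (simp add: algebra_simps flip: exp_of_nat_mult power_Suc)
  qed
  have K: "1 / h i * q_bessel_kernel \<xi> (exp (- (\<beta> * h i ^ 3))) (m i - 1 / 2) (n i - 1 / 2) = h i * suminf (g i)" for i
  proof -
    define a where "a j = q i powr (j + 1 / 2) * (J i (m i + int j) * J i (n i + int j))" for j :: nat
    have ga: "g i j = Q i / (h i)\<^sup>2 * a j" for j
      by (simp add: g_def a_def power2_eq_square)
    have "q_bessel_kernel \<xi> (q i) (m i - 1 / 2) (n i - 1 / 2) = Q i * suminf a"
      unfolding Q_def a_def J_def by (rule q_bessel_kernel_series[OF q \<xi> \<xi>1])
    \<comment> \<open>Summability of the unscaled terms is inherited from \<open>g\<close>, since
      \<open>Q i\<close> does not vanish.\<close>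
    moreover have "suminf (g i) = Q i / (h i)\<^sup>2 * suminf a"
    proof -
      have Qn: "Q i \<noteq> 0" using q[of i] by (simp add: Q_def)
      have "a = (\<lambda>j. (h i)\<^sup>2 / Q i * g i j)" unfolding ga using Qn h(1)[of i] by simp
      moreover have "summable (\<lambda>j. (h i)\<^sup>2 / Q i * g i j)"
        by (rule summable_mult[OF summable_rabs_cancel[OF gs]])
      ultimately have "summable a" by (simp only:)
      then show ?thesis unfolding ga by (rule suminf_mult)
    qed
    ultimately show ?thesis
      using h(1)[of i] by (simp add: q_def \<epsilon>_def power2_eq_square)
  qed
  define f where "f i z = indicator {0..} z * g i (nat \<lfloor>z / h i\<rfloor>)" for i and z :: real
  define f0 where "f0 z = indicator {0..} z * (airy (x + z) * airy (y + z))" for z :: real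
  have lim: "(\<lambda>i. f i z) \<longlonglongrightarrow> f0 z" for z
  proof (cases "z \<ge> 0")
    case True
    define j where "j i = nat \<lfloor>z / h i\<rfloor>" for i
    have hj: "\<bar>h i * j i - z\<bar> \<le> h i" for i
    proof -
      have "real (j i) = of_int \<lfloor>z / h i\<rfloor>" using True h(1)[of i] by (simp add: j_def)
      then have "real (j i) \<le> z / h i" "z / h i < real (j i) + 1" by linarith+
      then show ?thesis using h(1)[of i] by (simp add: field_simps abs_le_iff)
    qed
    have zl: "(\<lambda>i. h i * j i) \<longlonglongrightarrow> z"
      by (rule LIM_zero_cancel, rule Lim_null_comparison[OF _ h(3)]) (simp add: hj)
    have "(\<lambda>i. M i + h i * j i) \<longlonglongrightarrow> x + z" "(\<lambda>i. N i + h i * j i) \<longlonglongrightarrow> y + z"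
      by (intro tendsto_add M N zl)+
    then have "(\<lambda>i. h i * ((real_of_int (m i) + j i) - \<alpha> / (\<beta> * h i ^ 3))) \<longlonglongrightarrow> x + z"
      "(\<lambda>i. h i * ((real_of_int (n i) + j i) - \<alpha> / (\<beta> * h i ^ 3))) \<longlonglongrightarrow> y + z"
      by (simp_all add: M_def N_def \<epsilon>_def algebra_simps)
    moreover have "(\<lambda>i. J i (k i + int (j i)) / h i) \<longlonglongrightarrow> airy w / (1 - \<xi>)"
      if "(\<lambda>i. h i * ((real_of_int (k i) + j i) - \<alpha> / (\<beta> * h i ^ 3))) \<longlonglongrightarrow> w" for k w
      unfolding J_def q_def \<epsilon>_def \<beta>_def
      by (rule hahn_exton_int_tendsto_airy[OF \<xi> \<delta> h]) (use that in \<open>simp add: \<alpha>_def \<beta>_def\<close>)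
    ultimately have "(\<lambda>i. J i (m i + int (j i)) / h i) \<longlonglongrightarrow> airy (x + z) / (1 - \<xi>)"
      "(\<lambda>i. J i (n i + int (j i)) / h i) \<longlonglongrightarrow> airy (y + z) / (1 - \<xi>)"
      by blast+
    \<comment> \<open>Here \<open>j\<close> grows at most like \<open>1 / h\<close> while \<epsilon>
      is of order \<open>h ^ 3\<close>, so the exponent vanishes.\<close>
    moreover have "(\<lambda>i. q i powr (j i + 1 / 2)) \<longlonglongrightarrow> 1"
    proof -
      have "q i powr (j i + 1 / 2) = exp (- (\<beta> * (h i)\<^sup>2 * (h i * j i) + \<beta> * h i ^ 3 / 2))" for i
        using q[of i] by (simp add: powr_def q_def \<epsilon>_def field_simps power2_eq_square power3_eq_cube)
      moreover have "(\<lambda>i. exp (- (\<beta> * (h i)\<^sup>2 * (h i * j i) + \<beta> * h i ^ 3 / 2))) \<longlonglongrightarrow> exp (- (\<beta> * 0\<^sup>2 * z + \<beta> * 0 ^ 3 / 2))"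
        by (intro tendsto_intros h(3) zl) auto
      ultimately show ?thesis by simp
    qed
    ultimately have "(\<lambda>i. g i (j i)) \<longlonglongrightarrow> (1 - \<xi>)\<^sup>2 * (1 * ((airy (x + z) / (1 - \<xi>)) * (airy (y + z) / (1 - \<xi>))))"
      unfolding g_def by (intro tendsto_mult Q)
    then show ?thesis using True \<xi>1 by (simp add: f_def f0_def j_def power2_eq_square)
  qed (simp add: f_def f0_def)
  have meas: "f i \<in> borel_measurable lborel" for i unfolding f_def by measurable
  \<comment> \<open>As a pointwise limit, \<open>f0\<close> is measurable without any regularity of
    \<open>airy\<close>.\<close>
  have meas0: "f0 \<in> borel_measurable lborel" by (rule borel_measurable_LIMSEQ_real[OF lim meas])
  have w: "integrable lborel (\<lambda>z. W * (indicator {0..} z * exp (- 2 * z)))"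
    by (intro integrable_mult_right integrable_exp_neg_Ici) simp
  have bound: "norm (f i z) \<le> W * (indicator {0..} z * exp (- 2 * z))" for i z
  proof (cases "z \<ge> 0")
    case True
    have "z / h i < real (nat \<lfloor>z / h i\<rfloor>) + 1" using True h(1)[of i] by (simp add: floor_less_iff)
    then have "z \<le> h i * (real (nat \<lfloor>z / h i\<rfloor>) + 1)" using h(1)[of i] by (simp add: field_simps)
    then have "W * exp (- (2 * (h i * (real (nat \<lfloor>z / h i\<rfloor>) + 1)))) \<le> W * exp (- 2 * z)"
      using W0 by (intro mult_left_mono) auto
    then show ?thesis using gb[of i "nat \<lfloor>z / h i\<rfloor>"] True by (simp add: f_def)
  qed (simp add: f_def)
  have "(\<lambda>i. integral\<^sup>L lborel (f i)) \<longlonglongrightarrow> integral\<^sup>L lborel f0"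
    by (rule integral_dominated_convergence[OF meas0 meas w]) (use lim bound in auto)
  moreover have "integral\<^sup>L lborel (f i) = h i * suminf (g i)" for i
    unfolding f_def by (rule integral_step_function[OF h(1) gs])
  moreover have "integral\<^sup>L lborel f0 = airy_kernel x y"
  proof -
    \<comment> \<open>\<open>airy_kernel\<close> is a gauge integral; Lebesgue integrability of the
      limit identifies the two integrals.\<close>
    have "integrable lborel f0"
      by (rule integrable_dominated_convergence[where s = f, OF meas0 meas w]) (use lim bound in auto)
    then have "set_integrable lborel {0..} (\<lambda>z. airy (x + z) * airy (y + z))"
      by (simp add: set_integrable_def f0_def[abs_def])
    from set_borel_integral_eq_integral(2)[OF this] show ?thesis
      by (simp add: airy_kernel_def set_lebesgue_integral_def f0_def[abs_def])
  qed
  ultimately show ?thesis unfolding K by simp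
qed

text \<open>The kernel lives on half-integers, so the scaled arguments are represented by arbitrary
  half-integers within distance 1. At \<open>\<xi> = 0\<close> the scaling factor itself would be
  0.\<close>

theorem proposition2p8:
  fixes \<xi> \<alpha>\<^sub>0 \<beta>\<^sub>0 x y :: real and r s :: "real \<Rightarrow> real"
  assumes "0 < \<xi>" and "\<xi> < 1"
    and "\<alpha>\<^sub>0 = - 2 * ln (1 - \<xi>)"
    and "\<beta>\<^sub>0 = \<xi> / (1 - \<xi>)\<^sup>2"
    and "\<And>q. 0 < q \<Longrightarrow> q < 1 \<Longrightarrow> r q \<in> half_integers \<and>
           \<bar>r q - (- \<alpha>\<^sub>0 / ln q + (- \<beta>\<^sub>0 / ln q) powr (1/3) * x)\<bar> < 1"
    and "\<And>q. 0 < q \<Longrightarrow> q < 1 \<Longrightarrow> s q \<in> half_integers \<and>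
           \<bar>s q - (- \<alpha>\<^sub>0 / ln q + (- \<beta>\<^sub>0 / ln q) powr (1/3) * y)\<bar> < 1"
  shows "((\<lambda>q. (- \<beta>\<^sub>0 / ln q) powr (1/3) * q_bessel_kernel \<xi> q (r q) (s q))
           \<longlongrightarrow> airy_kernel x y) (at_left 1)"
proof -
  \<comment> \<open>Half of the critical exponent: \<open>\<xi> * exp \<delta>\<close> is the square
    root of \<xi>.\<close>
  define \<delta> where "\<delta> = - ln \<xi> / 2"
  have \<delta>0: "\<delta> > 0" using assms(1,2) by (simp add: \<delta>_def)
  have "exp \<delta> < exp (- ln \<xi>)" using \<delta>0 by (simp add: \<delta>_def)
  then have \<delta>: "\<xi> * exp \<delta> < 1" using assms(1) by (simp add: exp_minus field_simps)
  have \<beta>: "\<beta>\<^sub>0 > 0" using assms(1,2,4) by simp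
  have hi: "\<exists>k. t + 1 / 2 = real_of_int k" if "t \<in> half_integers" for t
  proof -
    obtain k where "t - 1 / 2 = of_int k" using \<open>t \<in> half_integers\<close> by (auto simp: half_integers_def elim: Ints_cases)
    then show ?thesis by (intro exI[of _ "k + 1"]) simp
  qed
  \<comment> \<open>The value of \<open>q\<close> at which \<open>h = \<delta>\<close>; staying
    above it guarantees \<open>h i \<le> \<delta>\<close> for every \<open>i\<close>.\<close>
  let ?b = "exp (- (\<beta>\<^sub>0 * \<delta> ^ 3))"
  show ?thesis
  proof (rule tendsto_at_left_sequentially[of ?b])
    show "?b < 1" using \<beta> \<delta>0 by simp
    fix q :: "nat \<Rightarrow> real"
    assume q1: "\<And>i. q i < 1" and qb: "\<And>i. ?b < q i" and lim: "q \<longlonglongrightarrow> 1"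
    have q0: "0 < q i" for i using qb[of i] exp_gt_zero[of "- (\<beta>\<^sub>0 * \<delta> ^ 3)"] by linarith
    have lnq: "ln (q i) < 0" for i using q0 q1 by (simp add: ln_less_zero_iff)
    define h where "h i = root 3 (- ln (q i) / \<beta>\<^sub>0)" for i
    have h0: "0 < h i" for i using lnq[of i] \<beta> by (simp add: h_def divide_neg_pos)
    have h3: "\<beta>\<^sub>0 * h i ^ 3 = - ln (q i)" for i using \<beta> by (simp add: h_def odd_real_root_pow)
    have eq: "exp (- (\<beta>\<^sub>0 * h i ^ 3)) = q i" for i unfolding h3 using q0[of i] by simp
    have h1: "(- \<beta>\<^sub>0 / ln (q i)) powr (1 / 3) = 1 / h i" for i
    proof -
      have "- \<beta>\<^sub>0 / ln (q i) = (1 / h i) ^ 3"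
        using h3[of i] h0[of i] lnq[of i] by (simp add: field_simps)
      also have "\<dots> = (1 / h i) powr 3" using h0[of i] by (simp add: powr_numeral)
      also have "\<dots> powr (1 / 3) = 1 / h i" unfolding powr_powr using h0[of i] by simp
      finally show ?thesis .
    qed
    have h\<delta>: "h i \<le> \<delta>" for i
    proof -
      have "- (\<beta>\<^sub>0 * \<delta> ^ 3) < ln (q i)" using qb[of i] q0[of i] by (metis exp_less_cancel_iff exp_ln)
      then have "\<beta>\<^sub>0 * h i ^ 3 \<le> \<beta>\<^sub>0 * \<delta> ^ 3" unfolding h3 by simp
      then have "h i ^ 3 \<le> \<delta> ^ 3" using \<beta> by simp
      then show ?thesis using h0[of i] \<delta>0 by (simp add: power_mono_iff)
    qed
    have "h \<longlonglongrightarrow> root 3 (- ln 1 / \<beta>\<^sub>0)"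
      unfolding h_def using \<beta> by (intro tendsto_intros lim) auto
    then have hl: "h \<longlonglongrightarrow> 0" by simp
    obtain m where m: "\<And>i. r (q i) + 1 / 2 = real_of_int (m i)" using hi[OF conjunct1[OF assms(5)[OF q0 q1]]] by metis
    obtain n where n: "\<And>i. s (q i) + 1 / 2 = real_of_int (n i)" using hi[OF conjunct1[OF assms(6)[OF q0 q1]]] by metis
    have rm: "r (q i) = m i - 1 / 2" "s (q i) = n i - 1 / 2" for i using m[of i] n[of i] by simp_all
    have "\<bar>m i - 1 / 2 - (\<alpha>\<^sub>0 / (\<beta>\<^sub>0 * h i ^ 3) + x / h i)\<bar> < 1"
      "\<bar>n i - 1 / 2 - (\<alpha>\<^sub>0 / (\<beta>\<^sub>0 * h i ^ 3) + y / h i)\<bar> < 1" for i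
      using assms(5,6)[OF q0[of i] q1[of i]] unfolding rm h1 h3 by simp_all
    from q_bessel_kernel_tendsto_airy_kernel[OF assms(1) \<delta> h0 h\<delta> hl this[unfolded assms(3,4)], folded assms(4)]
    show "(\<lambda>i. (- \<beta>\<^sub>0 / ln (q i)) powr (1/3) * q_bessel_kernel \<xi> (q i) (r (q i)) (s (q i))) \<longlonglongrightarrow> airy_kernel x y"
      unfolding h1 rm eq .
  qed
qed

end
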